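(* Let $d\ge1$, $\alpha\in(0,1)$, $\theta_0\in\mathbb{R}^d$, and let $X_1,\ldots,X_n$ be independent and identically distributed from $P$. Let $\widehat{\mathrm{CI}}_\alpha$ be the rectangular hull confidence region (described in the context), with batch estimators $\widehat{\theta}^{(j)}$, $1\le j\le B^*$. Suppose that these estimators (for each of the two possible values of $B^*$) satisfy $$\widehat{\theta}^{(j)}-\theta_0\in\mathrm{MCH}\quad\text{and}\quad \mathrm{O\mbox{-}Med\mbox{-}bias}_P(\widehat{\theta}^{(j)};\theta_0)\le\delta_{n/B_{\alpha,d}},$$ where $\delta_{n/B_{\alpha,d}}\ge0$ is a real number. Then $$\alpha-2^{d-1}B_{\alpha,d}(B_{\alpha,d}-1)\,\delta_{n/B_{\alpha,d}}^2\ \le\ \mathbb{P}(\theta_0\notin\widehat{\mathrm{CI}}_\alpha)\ \le\ \alpha+2^{d-1}B_{\alpha,d}(B_{\alpha,d}-1)\,\delta_{n/B_{\alpha,d}}^2.$$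
   Context: A random vector $W$ in $\mathbb{R}^d$ is MCH (written $W\in\mathrm{MCH}$) if $\mathbb{P}(W_j=0\text{ for some }1\le j\le d)=0$. Let $\mathcal{O}^d$ be the collection of the $2^d$ closed orthants $\{x\in\mathbb{R}^d:\eta_jx_j\ge0,\ 1\le j\le d\}$, $\eta\in\{-1,1\}^d$. If $\widehat{\theta}-\theta_0\in\mathrm{MCH}$, then $$\mathrm{O\mbox{-}Med\mbox{-}bias}_P(\widehat{\theta};\theta_0):=2^{d-1}\left(\frac1{2^d}-\min_{A\in\mathcal{O}^d}\mathbb{P}(\widehat{\theta}-\theta_0\in A)\right)_+,\qquad (t)_+=\max\{t,0\}.$$ Rectangular hull confidence region. Let $\mathcal{A}(\cdot)$ be an estimation procedure that takes observations as input and returns an estimator in $\mathbb{R}^d$. For integers $B\ge1$ let $$U(B,0;d):=\sum_{j=1}^d(-1)^{j-1}\binom dj2^j\left(\frac1{2^j}\right)^B = 1-(1-2^{-B+1})^d.$$ Set $B_{\alpha,d}:=\left\lceil 1-\log_2\left(1-(1-\alpha)^{1/d}\right)\right\rceil$ (assume $n\ge B_{\alpha,d}$). Generate a random variable $V\sim\mathrm{Uniform}[0,1]$ independent of the data, and set $$\tau_{\alpha,d}:=\frac{\alpha-U(B_{\alpha,d},0;d)}{U(B_{\alpha,d}-1,0;d)-U(B_{\alpha,d},0;d)},\qquad B^*:=\begin{cases}B_{\alpha,d}-1,&V\le\tau_{\alpha,d},\\ B_{\alpha,d},&V>\tau_{\alpha,d}.\end{cases}$$ Randomly (independently of the data values)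 split $X_1,\ldots,X_n$ into $B^*$ disjoint batches $\{X_i:i\in S_j\}$, $1\le j\le B^*$, all of equal size $\lfloor n/B^*\rfloor$, discarding some observations if needed. Compute $\widehat{\theta}^{(j)}:=\mathcal{A}(\{X_i:i\in S_j\})$ for $1\le j\le B^*$, and return $$\widehat{\mathrm{CI}}_\alpha:=\prod_{j=1}^d\left[\min_{1\le k\le B^*}e_j^\top\widehat{\theta}^{(k)},\ \max_{1\le k\le B^*}e_j^\top\widehat{\theta}^{(k)}\right],$$ where $e_j$ is the $j$-th canonical basis vector of $\mathbb{R}^d$. *)

theory Defs
  imports "HOL-Probability.Probability"
begin

text \<open>Independence of two random variables. The library's \<^const>\<open>prob_space.indep_var\<close> forces
  both variables to have the same value type; this drops that restriction.\<close>

definition indep_rv ::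
    "'w measure \<Rightarrow> 'a measure \<Rightarrow> ('w \<Rightarrow> 'a) \<Rightarrow> 'b measure \<Rightarrow> ('w \<Rightarrow> 'b) \<Rightarrow> bool" where
  "indep_rv M N f K g \<longleftrightarrow> f \<in> measurable M N \<and> g \<in> measurable M K \<and>
     prob_space.indep_set M {f -` A \<inter> space M | A. A \<in> sets N}
                            {g -` A \<inter> space M | A. A \<in> sets K}"

definition MCH :: "'w measure \<Rightarrow> ('w \<Rightarrow> real ^ 'd::finite) \<Rightarrow> bool" where
  "MCH M W \<longleftrightarrow> W \<in> borel_measurable M \<and>
     measure M {\<omega> \<in> space M. \<exists>j. W \<omega> $ j = 0} = 0"

definition closed_orthants :: "(real ^ 'd::finite) set set" where
  "closed_orthants = {{x. \<forall>j. \<eta> j * x $ j \<ge> 0} | \<eta>. \<forall>j. \<eta> j \<in> {-1, 1}}"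

text \<open>This is the form taken by the orthant median bias under the MCH condition;
  it is only used together with \<^const>\<open>MCH\<close>.\<close>

definition O_Med_bias ::
    "'w measure \<Rightarrow> ('w \<Rightarrow> real ^ 'd::finite) \<Rightarrow> real ^ 'd \<Rightarrow> real" where
  "O_Med_bias M \<theta> \<theta>\<^sub>0 = 2 ^ (CARD('d) - 1) *
     max 0 (1 / 2 ^ CARD('d) -
       (MIN A \<in> (closed_orthants :: (real ^ 'd) set set).
          measure M {\<omega> \<in> space M. \<theta> \<omega> - \<theta>\<^sub>0 \<in> A}))"

definition hull_U :: "nat \<Rightarrow> nat \<Rightarrow> real" where
  "hull_U B d = (\<Sum>j=1..d. (-1) ^ (j - 1) * real (d choose j) * 2 ^ j * (1 / 2 ^ j) ^ B)"

text \<open>For \<open>0 < \<alpha> < 1\<close> and \<open>d \<ge> 1\<close> the integer below is at least 2, so neither \<open>nat\<close> here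
  nor the subtractions of 1 on natural numbers further down truncate.\<close>

definition hull_B :: "real \<Rightarrow> nat \<Rightarrow> nat" where
  "hull_B \<alpha> d = nat \<lceil>1 - log 2 (1 - (1 - \<alpha>) powr (1 / real d))\<rceil>"

definition hull_tau :: "real \<Rightarrow> nat \<Rightarrow> real" where
  "hull_tau \<alpha> d =
     (\<alpha> - hull_U (hull_B \<alpha> d) d) /
     (hull_U (hull_B \<alpha> d - 1) d - hull_U (hull_B \<alpha> d) d)"

text \<open>The randomised number of batches, as a function of the value \<open>v\<close> of the uniform variable.\<close>

definition hull_B_star :: "real \<Rightarrow> nat \<Rightarrow> real \<Rightarrow> nat" where
  "hull_B_star \<alpha> d v = (if v \<le> hull_tau \<alpha> d then hull_B \<alpha> d - 1 else hull_B \<alpha> d)"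

text \<open>The finite set of all ways to choose \<open>B\<close> disjoint batches of equal size
  \<open>\<lfloor>n / B\<rfloor>\<close> from the indices \<open>1, \<dots>, n\<close>.\<close>

definition batch_splits :: "nat \<Rightarrow> nat \<Rightarrow> (nat \<Rightarrow> nat set) set" where
  "batch_splits n B = {S \<in> {1..B} \<rightarrow>\<^sub>E Pow {1..n}.
     disjoint_family_on S {1..B} \<and> (\<forall>k\<in>{1..B}. card (S k) = n div B)}"

text \<open>An estimation procedure maps a finite sample, given as a list, to a vector, measurably
  for each sample size. It is not required to be invariant under reordering of the sample.\<close>

definition estimation_procedure ::
    "'x measure \<Rightarrow> ('x list \<Rightarrow> real ^ 'd::finite) \<Rightarrow> bool" where
  "estimation_procedure P \<A> \<longleftrightarrow>
     (\<forall>m. (\<lambda>x. \<A> (map x [1..<Suc m])) \<in> borel_measurable (\<Pi>\<^sub>M i\<in>{1..m}. P))"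

definition batch_estimator ::
    "('x list \<Rightarrow> real ^ 'd::finite) \<Rightarrow> (nat \<Rightarrow> 'w \<Rightarrow> 'x) \<Rightarrow> ('w \<Rightarrow> nat \<Rightarrow> nat set)
      \<Rightarrow> nat \<Rightarrow> 'w \<Rightarrow> real ^ 'd" where
  "batch_estimator \<A> X S k \<omega> = \<A> (map (\<lambda>i. X i \<omega>) (sorted_list_of_set (S \<omega> k)))"

definition rectangular_hull :: "nat \<Rightarrow> (nat \<Rightarrow> real ^ 'd::finite) \<Rightarrow> (real ^ 'd) set" where
  "rectangular_hull B t =
     cbox (\<chi> j. MIN k\<in>{1..B}. t k $ j) (\<chi> j. MAX k\<in>{1..B}. t k $ j)"

text \<open>The family \<open>S\<close> holds, for each number of batches \<open>B\<close>, a random split \<open>S B\<close> into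
  \<open>B\<close> batches; only the split for the realised number of batches is used.\<close>

definition hull_CI ::
    "('x list \<Rightarrow> real ^ 'd::finite) \<Rightarrow> (nat \<Rightarrow> 'w \<Rightarrow> 'x) \<Rightarrow> ('w \<Rightarrow> real)
      \<Rightarrow> (nat \<Rightarrow> 'w \<Rightarrow> nat \<Rightarrow> nat set) \<Rightarrow> real \<Rightarrow> 'w \<Rightarrow> (real ^ 'd) set" where
  "hull_CI \<A> X V S \<alpha> \<omega> =
     (let B = hull_B_star \<alpha> CARD('d) (V \<omega>)
      in rectangular_hull B (\<lambda>k. batch_estimator \<A> X (S B) k \<omega>))"

end

theory Submission
  imports Defs
begin

text \<open>Conditionally on \<open>V\<close> and the split, the batch estimators are independent with a common law, so
  whether \<open>\<theta>\<^sub>0\<close> is missed depends only on independent sign vectors in \<open>{\<plusminus>1}\<^sup>d\<close> with some law \<open>p\<close>: up to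
  null sets, a miss occurs iff all sign vectors agree in some coordinate. The bias bound says that
  \<open>p\<close> exceeds the uniform law \<open>u\<close> minus \<open>2\<delta>/2\<^sup>d\<close> pointwise, and under \<open>u\<close> the miss probability is
  \<open>hull_U\<close>. Expanding the multilinear miss probability at \<open>u\<close>, the first order term vanishes by
  symmetry under \<open>{\<plusminus>1}\<^sup>d\<close>, and the second order term is bounded by means of the total variation
  distance of \<open>p\<close> and \<open>u\<close>. Finally \<open>\<tau>\<close> interpolates between the two possible numbers of batches.\<close>

section \<open>Expectations over lists of independent draws\<close>

text \<open>The target is quadratic in \<delta>, so the linear term has to vanish exactly, while the
  hypothesis bounds \<open>p\<close> from below only. Total mass one repairs the latter: with N =
  2^d, no sign vector falls below 1/N by more than 2 \<delta> / N and at least one does not fall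
  below it at all, so the total variation distance is at most s = (N - 1) * 2 \<delta> / N. For b
  batches the expansion leaves b (b - 1) s^2, to be compared with 2^(d - 1) b (b - 1) \<delta>^2.
  For d = 1, s = \<delta> and the two agree; for d >= 3, s <= 2 \<delta> and 4 <= 2^(d - 1). For d =
  2, s^2 = 9/4 \<delta>^2 exceeds 2 \<delta>^2, so that case rests on an exact formula for the miss
  probability. Sign vectors form the finite type \<open>'d => bool\<close>, so expectations over
  independent draws are finite sums. They are defined by recursion on the first draw so that one law
  can be exchanged for another one draw at a time; measure theory is confined to the passage from
  batch estimators to these sums.\<close>

fun list_exp :: "('h::finite \<Rightarrow> real) \<Rightarrow> nat \<Rightarrow> ('h list \<Rightarrow> real) \<Rightarrow> real" where
  "list_exp p 0 f = f []"
| "list_exp p (Suc n) f = (\<Sum>x\<in>UNIV. p x * list_exp p n (\<lambda>l. f (x # l)))"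

lemma sum_lists_Suc:
  fixes g :: "'h::finite list \<Rightarrow> real"
  shows "(\<Sum>l | length l = Suc n. g l) = (\<Sum>x\<in>UNIV. \<Sum>l | length l = n. g (x # l))"
proof -
  have "(\<Sum>l | length l = Suc n. g l) = (\<Sum>(x, l)\<in>UNIV \<times> {l. length l = n}. g (x # l))"
    by (rule sum.reindex_bij_witness[where i = "\<lambda>(x, l). x # l" and j = "\<lambda>l. (hd l, tl l)"])
       (auto simp: length_Suc_conv)
  also have "\<dots> = (\<Sum>x\<in>UNIV. \<Sum>l | length l = n. g (x # l))"
    by (simp add: sum.cartesian_product)
  finally show ?thesis .
qed

lemma list_exp_eq_sum:
  "list_exp p n f = (\<Sum>l | length l = n. prod_list (map p l) * f l)"
proof (induction n arbitrary: f)
  case (Suc n)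
  show ?case
    by (simp add: sum_lists_Suc Suc sum_distrib_left mult.assoc)
qed simp

lemma list_exp_cong:
  assumes "\<And>l. length l = n \<Longrightarrow> f l = g l"
  shows "list_exp p n f = list_exp p n g"
  by (simp add: list_exp_eq_sum assms)

lemma list_exp_add: "list_exp p n (\<lambda>l. f l + g l) = list_exp p n f + list_exp p n g"
  by (simp add: list_exp_eq_sum sum.distrib algebra_simps)

lemma list_exp_diff: "list_exp p n (\<lambda>l. f l - g l) = list_exp p n f - list_exp p n g"
  by (simp add: list_exp_eq_sum sum_subtractf algebra_simps)

lemma list_exp_const:
  assumes "sum p UNIV = 1"
  shows "list_exp p n (\<lambda>_. c) = c"
  by (induction n) (simp_all flip: sum_distrib_right add: assms)

lemma list_exp_all:
  "list_exp p n (\<lambda>l. of_bool (\<forall>y\<in>set l. y \<in> K)) = (\<Sum>x\<in>K. p x) ^ n"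
proof (induction n)
  case (Suc n)
  have "list_exp p (Suc n) (\<lambda>l. of_bool (\<forall>y\<in>set l. y \<in> K)) =
      (\<Sum>x\<in>UNIV. if x \<in> K then p x * (\<Sum>x\<in>K. p x) ^ n else 0)"
  proof (simp, rule sum.cong[OF refl])
    fix x
    show "p x * list_exp p n (\<lambda>l. of_bool (x \<in> K \<and> (\<forall>y\<in>set l. y \<in> K))) =
          (if x \<in> K then p x * sum p K ^ n else 0)"
      using Suc by (cases "x \<in> K") (auto simp: list_exp_eq_sum)
  qed
  also have "\<dots> = (\<Sum>x\<in>K. p x) ^ Suc n"
    by (simp add: sum.If_cases sum_distrib_right)
  finally show ?case .
qed simp

lemma list_exp_bounds:
  assumes "\<And>x. p x \<ge> 0" "sum p UNIV = 1" "\<And>l. 0 \<le> f l" "\<And>l. f l \<le> 1"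
  shows "0 \<le> list_exp p n f" "list_exp p n f \<le> 1"
proof -
  have "0 \<le> list_exp p n f \<and> list_exp p n f \<le> 1" using assms(3,4)
  proof (induction n arbitrary: f)
    case (Suc n)
    have *: "0 \<le> list_exp p n (\<lambda>l. f (x # l))" "list_exp p n (\<lambda>l. f (x # l)) \<le> 1" for x
      using Suc.IH[of "\<lambda>l. f (x # l)"] Suc.prems by auto
    have "(\<Sum>x\<in>UNIV. p x * list_exp p n (\<lambda>l. f (x # l))) \<le> (\<Sum>x\<in>UNIV. p x * 1)"
      by (intro sum_mono mult_left_mono * assms)
    then show ?case using * assms(1,2) by (auto intro!: sum_nonneg)
  qed auto
  then show "0 \<le> list_exp p n f" "list_exp p n f \<le> 1" by auto
qed

section \<open>Dependence of list expectations on the law of one draw\<close>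

text \<open>Zero total mass allows \<open>g\<close> to be recentred at 1/2, where its absolute value
  is at most 1/2. This halves the bound by the l1 norm and makes \<open>s\<close> act as a total
  variation distance.\<close>

lemma mean_zero_sum_bound:
  fixes e g :: "'h::finite \<Rightarrow> real"
  assumes "sum e UNIV = 0" "(\<Sum>x\<in>UNIV. \<bar>e x\<bar>) \<le> 2 * s" "\<And>x. 0 \<le> g x" "\<And>x. g x \<le> 1"
  shows "\<bar>\<Sum>x\<in>UNIV. e x * g x\<bar> \<le> s"
proof -
  have "(\<Sum>x\<in>UNIV. e x * g x) = (\<Sum>x\<in>UNIV. e x * (g x - 1 / 2))"
    using assms(1) by (simp add: algebra_simps sum_subtractf flip: sum_divide_distrib)
  also have "\<bar>\<dots>\<bar> \<le> (\<Sum>x\<in>UNIV. \<bar>e x * (g x - 1 / 2)\<bar>)" by (rule sum_abs)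
  also have "\<dots> \<le> (\<Sum>x\<in>UNIV. \<bar>e x\<bar> * (1 / 2))"
  proof (rule sum_mono)
    fix x
    have "\<bar>g x - 1 / 2\<bar> \<le> 1 / 2" using assms(3,4)[of x] by (auto simp: abs_if field_simps)
    then show "\<bar>e x * (g x - 1 / 2)\<bar> \<le> \<bar>e x\<bar> * (1 / 2)"
      by (simp only: abs_mult) (intro mult_left_mono, auto)
  qed
  also have "\<dots> \<le> s" using assms(2) by (simp flip: sum_divide_distrib)
  finally show ?thesis .
qed

lemma convex_combination_abs_le:
  fixes p g :: "'h::finite \<Rightarrow> real"
  assumes "\<And>x. p x \<ge> 0" "sum p UNIV = 1" "\<And>x. \<bar>g x\<bar> \<le> c"
  shows "\<bar>\<Sum>x\<in>UNIV. p x * g x\<bar> \<le> c"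
proof -
  have "\<bar>\<Sum>x\<in>UNIV. p x * g x\<bar> \<le> (\<Sum>x\<in>UNIV. \<bar>p x * g x\<bar>)" by (rule sum_abs)
  also have "\<dots> \<le> (\<Sum>x\<in>UNIV. p x * c)"
    using assms by (intro sum_mono) (auto simp: abs_mult intro!: mult_left_mono)
  also have "\<dots> = c" using assms(2) by (simp flip: sum_distrib_right)
  finally show ?thesis .
qed

text \<open>The draws are exchanged one at a time: changing the law of the first draw costs
  \<open>s\<close>, and the induction hypothesis pays for the others.\<close>

lemma list_exp_total_variation:
  assumes p: "\<And>x. p x \<ge> 0" "sum p UNIV = 1" and q: "\<And>x. q x \<ge> 0" "sum q UNIV = 1"
    and s: "(\<Sum>x\<in>UNIV. \<bar>p x - q x\<bar>) \<le> 2 * s"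
    and f: "\<And>l. 0 \<le> f l" "\<And>l. f l \<le> 1"
  shows "\<bar>list_exp p n f - list_exp q n f\<bar> \<le> real n * s"
  using f
proof (induction n arbitrary: f)
  case (Suc n)
  let ?F = "\<lambda>x l. f (x # l)"
  have "list_exp p (Suc n) f - list_exp q (Suc n) f =
      (\<Sum>x\<in>UNIV. p x * (list_exp p n (?F x) - list_exp q n (?F x)))
      + (\<Sum>x\<in>UNIV. (p x - q x) * list_exp q n (?F x))"
    by (simp add: algebra_simps sum_subtractf flip: sum.distrib)
  moreover have "\<bar>\<Sum>x\<in>UNIV. p x * (list_exp p n (?F x) - list_exp q n (?F x))\<bar> \<le> real n * s"
    using Suc.prems by (intro convex_combination_abs_le p Suc.IH) auto
  moreover have "\<bar>\<Sum>x\<in>UNIV. (p x - q x) * list_exp q n (?F x)\<bar> \<le> s"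
    using Suc.prems p q s
    by (intro mean_zero_sum_bound list_exp_bounds) (auto simp: sum_subtractf)
  ultimately show ?case by (simp add: algebra_simps)
qed simp

text \<open>The derivative of \<open>\<lambda>q. list_exp q n f\<close> at \<open>u\<close> in the direction \<open>e\<close>.\<close>

fun list_exp_deriv ::
    "('h::finite \<Rightarrow> real) \<Rightarrow> ('h \<Rightarrow> real) \<Rightarrow> nat \<Rightarrow> ('h list \<Rightarrow> real) \<Rightarrow> real" where
  "list_exp_deriv u e 0 f = 0"
| "list_exp_deriv u e (Suc n) f = (\<Sum>x\<in>UNIV. e x * list_exp u n (\<lambda>l. f (x # l)))
     + (\<Sum>x\<in>UNIV. u x * list_exp_deriv u e n (\<lambda>l. f (x # l)))"

text \<open>Splitting off the first draw turns the remainder for \<open>Suc n\<close> into a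
  \<open>q\<close>-average of remainders for \<open>n\<close> plus a product of two first order
  differences. The constant follows from n (n - 1) + 2 n = (n + 1) n.\<close>

lemma list_exp_taylor:
  assumes p: "\<And>x. p x \<ge> 0" "sum p UNIV = 1" and q: "\<And>x. q x \<ge> 0" "sum q UNIV = 1"
    and s: "(\<Sum>x\<in>UNIV. \<bar>p x - q x\<bar>) \<le> 2 * s"
    and f: "\<And>l. 0 \<le> f l" "\<And>l. f l \<le> 1"
  shows "\<bar>list_exp p n f - list_exp q n f - list_exp_deriv q (\<lambda>x. p x - q x) n f\<bar>
           \<le> real n * (real n - 1) * s\<^sup>2"
  using f
proof (induction n arbitrary: f)
  case (Suc n)
  let ?F = "\<lambda>x l. f (x # l)" and ?L = "list_exp_deriv q (\<lambda>x. p x - q x)"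
  let ?r = "\<lambda>x. list_exp p n (?F x) - list_exp q n (?F x)"
  have "list_exp p (Suc n) f - list_exp q (Suc n) f - ?L (Suc n) f =
      (\<Sum>x\<in>UNIV. q x * (?r x - ?L n (?F x))) + (\<Sum>x\<in>UNIV. (p x - q x) * ?r x)"
    by (simp add: algebra_simps sum_subtractf sum.distrib)
  moreover have "\<bar>\<Sum>x\<in>UNIV. q x * (?r x - ?L n (?F x))\<bar> \<le> real n * (real n - 1) * s\<^sup>2"
    using Suc.prems by (intro convex_combination_abs_le q Suc.IH) auto
  \<comment> \<open>Here \<open>?r\<close> may take either sign, ranging over an interval of length
    2 n s around 0, so recentring gains nothing: the l1 norm 2 s is multiplied by the bound n s on
    \<open>?r\<close>.\<close>
  moreover have "\<bar>\<Sum>x\<in>UNIV. (p x - q x) * ?r x\<bar> \<le> 2 * s * (real n * s)"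
  proof -
    have "\<bar>\<Sum>x\<in>UNIV. (p x - q x) * ?r x\<bar> \<le> (\<Sum>x\<in>UNIV. \<bar>p x - q x\<bar> * (real n * s))"
      using Suc.prems
      by (intro order.trans[OF sum_abs] sum_mono)
         (auto simp: abs_mult intro!: mult_left_mono list_exp_total_variation p q s)
    also have "\<dots> \<le> 2 * s * (real n * s)"
    proof -
      have "0 \<le> (\<Sum>x\<in>UNIV. \<bar>p x - q x\<bar>)" by (intro sum_nonneg) auto
      then have "0 \<le> s" using s by linarith
      then show ?thesis
        using s by (simp flip: sum_distrib_right) (intro mult_right_mono, auto)
    qed
    finally show ?thesis .
  qed
  ultimately show ?case by (simp add: algebra_simps power2_eq_square)
qed simp

lemma list_exp_bij:
  assumes "bij g" "\<And>x. u (g x) = u x"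
  shows "list_exp u n (\<lambda>l. f (map g l)) = list_exp u n f"
proof (induction n arbitrary: f)
  case (Suc n)
  have "list_exp u (Suc n) (\<lambda>l. f (map g l)) = (\<Sum>x\<in>UNIV. u (g x) * list_exp u n (\<lambda>l. f (g x # l)))"
    using Suc[of "\<lambda>l. f (_ # l)"] by (simp add: assms(2))
  also have "\<dots> = (\<Sum>x\<in>UNIV. u x * list_exp u n (\<lambda>l. f (x # l)))"
    by (rule sum.reindex_bij_betw[OF assms(1)])
  finally show ?case by simp
qed simp

text \<open>A change of variables in every draw moves a symmetry of \<open>u\<close> from the test
  function to the direction. If \<open>f\<close> is invariant as well, the derivative of
  \<open>f\<close> is the same in the direction \<open>e\<close> and in all its translates.\<close>

lemma list_exp_deriv_bij:
  assumes "bij g" "\<And>x. u (g x) = u x"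
  shows "list_exp_deriv u (\<lambda>x. e (g x)) n (\<lambda>l. f (map g l)) = list_exp_deriv u e n f"
proof (induction n arbitrary: f)
  case (Suc n)
  have "list_exp_deriv u (\<lambda>x. e (g x)) (Suc n) (\<lambda>l. f (map g l)) =
      (\<Sum>x\<in>UNIV. e (g x) * list_exp u n (\<lambda>l. f (g x # l)))
      + (\<Sum>x\<in>UNIV. u (g x) * list_exp_deriv u e n (\<lambda>l. f (g x # l)))"
    using Suc[of "\<lambda>l. f (_ # l)"] list_exp_bij[where u = u and g = g, OF assms, of n "\<lambda>l. f (_ # l)"]
    by (simp add: assms(2))
  also have "\<dots> = (\<Sum>x\<in>UNIV. e x * list_exp u n (\<lambda>l. f (x # l)))
      + (\<Sum>x\<in>UNIV. u x * list_exp_deriv u e n (\<lambda>l. f (x # l)))"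
    by (intro arg_cong2[where f = "(+)"] sum.reindex_bij_betw[OF assms(1)])
  finally show ?case by simp
qed simp

lemma list_exp_deriv_sum:
  "list_exp_deriv u (\<lambda>x. \<Sum>i\<in>I. e i x) n f = (\<Sum>i\<in>I. list_exp_deriv u (e i) n f)"
proof (induction n arbitrary: f)
  case (Suc n)
  have swap: "(\<Sum>x\<in>UNIV. \<Sum>i\<in>I. g i x) = (\<Sum>i\<in>I. \<Sum>x\<in>UNIV. g i x)" for g :: "_ \<Rightarrow> _ \<Rightarrow> real"
    by (rule sum.swap)
  show ?case
    by (simp only: list_exp_deriv.simps Suc sum.distrib sum_distrib_left sum_distrib_right swap)
qed simp

lemma list_exp_deriv_zero: "list_exp_deriv u (\<lambda>_. 0) n f = 0"
  by (induction n arbitrary: f) simp_all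

text \<open>Averaging the direction over a transitive symmetry group of \<open>f\<close> makes it constant,
  hence zero when its total mass is zero. The group is \<open>{\<plusminus>1}\<^sup>d\<close>, with \<open>\<noteq>\<close> as multiplication.\<close>

lemma list_exp_deriv_eq_0:
  fixes e :: "('d::finite \<Rightarrow> bool) \<Rightarrow> real"
  assumes "sum e UNIV = 0"
    and inv: "\<And>g l. f (map (\<lambda>x j. x j \<noteq> g j) l) = f l"
  shows "list_exp_deriv (\<lambda>_. c) e n f = 0"
proof -
  let ?t = "\<lambda>(g :: 'd \<Rightarrow> bool) (x :: 'd \<Rightarrow> bool) j. x j \<noteq> g j"
  have bij: "bij (?t g)" for g by (rule o_bij[of "?t g"]) (auto simp: fun_eq_iff)
  have "list_exp_deriv (\<lambda>_. c) (\<lambda>x. e (?t g x)) n f = list_exp_deriv (\<lambda>_. c) e n f" for g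
    using list_exp_deriv_bij[OF bij, of "\<lambda>_. c" g e n f] inv by simp
  then have "real CARD('d \<Rightarrow> bool) * list_exp_deriv (\<lambda>_. c) e n f =
      (\<Sum>g\<in>UNIV. list_exp_deriv (\<lambda>_. c) (\<lambda>x. e (?t g x)) n f)"
    by simp
  also have "\<dots> = list_exp_deriv (\<lambda>_. c) (\<lambda>x. \<Sum>g\<in>UNIV. e (?t g x)) n f"
    by (rule list_exp_deriv_sum[symmetric])
  also have "(\<lambda>x. \<Sum>g\<in>UNIV. e (?t g x)) = (\<lambda>_. 0)"
  proof
    fix x
    \<comment> \<open>The operation is commutative, so summing over the group with \<open>x\<close>
      fixed runs through the whole orbit of \<open>x\<close>, which is everything.\<close>
    have "(\<Sum>g\<in>UNIV. e (?t g x)) = (\<Sum>g\<in>UNIV. e (?t x g))"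
      by (intro sum.cong refl arg_cong[where f = e]) auto
    also have "\<dots> = sum e UNIV" by (rule sum.reindex_bij_betw[OF bij])
    finally show "(\<Sum>g\<in>UNIV. e (?t g x)) = 0" using assms(1) by simp
  qed
  finally show ?thesis by (simp add: list_exp_deriv_zero)
qed

section \<open>The miss event on lists of sign vectors\<close>

definition const_coord :: "('d \<Rightarrow> bool) list \<Rightarrow> bool" where
  "const_coord l \<longleftrightarrow> (\<exists>j s. \<forall>x\<in>set l. x j = s)"

text \<open>Translation by \<open>g\<close> turns a common sign \<open>s\<close> in coordinate
  \<open>j\<close> into the common sign \<open>s \<noteq> g j\<close>. The converse follows because
  translating twice is the identity.\<close>

lemma const_coord_translate: "const_coord (map (\<lambda>x j. x j \<noteq> g j) l) = const_coord l"
proof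
  have imp: "const_coord (map (\<lambda>x j. x j \<noteq> g j) l)" if "const_coord l" for l
  proof -
    from that obtain j s where "\<forall>x\<in>set l. x j = s" by (auto simp: const_coord_def)
    then have "\<forall>y\<in>set (map (\<lambda>x j. x j \<noteq> g j) l). y j = (s \<noteq> g j)" by auto
    then show ?thesis unfolding const_coord_def by blast
  qed
  show "const_coord (map (\<lambda>x j. x j \<noteq> g j) l)" if "const_coord l" using that by (rule imp)
  have eq: "(\<lambda>j. (x j \<noteq> g j) \<noteq> g j) = x" for x :: "'a \<Rightarrow> bool" by (rule ext) auto
  show "const_coord l" if "const_coord (map (\<lambda>x j. x j \<noteq> g j) l)"
    using imp[OF that] by (simp only: map_map comp_def eq) simp
qed

text \<open>The coordinates of a uniform sign vector are independent fair bits. Distributing the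
  product over the sums of the first bits gives the sum over first vectors; \<open>h\<close> depends
  on \<open>j\<close> because the induction hypothesis is applied with the first bits already
  inserted.\<close>

lemma list_exp_prod:
  fixes h :: "'d::finite \<Rightarrow> bool list \<Rightarrow> real"
  shows "list_exp (\<lambda>_. 1 / 2 ^ CARD('d)) n (\<lambda>l. \<Prod>j\<in>UNIV. h j (map (\<lambda>x. x j) l)) =
    (\<Prod>j\<in>UNIV. list_exp (\<lambda>_. 1 / 2) n (h j))"
proof (induction n arbitrary: h)
  case (Suc n)
  let ?G = "\<lambda>j b. list_exp (\<lambda>_. 1 / 2) n (\<lambda>l. h j (b # l))"
  have "(\<Prod>j\<in>UNIV. list_exp (\<lambda>_. 1 / 2) (Suc n) (h j)) =
      (\<Prod>j\<in>UNIV. \<Sum>b\<in>UNIV. 1 / 2 * ?G j b)" by simp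
  also have "\<dots> = (\<Sum>x\<in>UNIV. \<Prod>j\<in>UNIV. 1 / 2 * ?G j (x j))"
    by (subst prod_sum_PiE) auto
  also have "\<dots> = (\<Sum>x\<in>UNIV. 1 / 2 ^ CARD('d) * (\<Prod>j\<in>UNIV. ?G j (x j)))"
    by (simp only: prod.distrib) (simp add: power_one_over)
  also have "\<dots> = list_exp (\<lambda>_. 1 / 2 ^ CARD('d)) (Suc n) (\<lambda>l. \<Prod>j\<in>UNIV. h j (map (\<lambda>x. x j) l))"
    by (simp add: Suc[of "\<lambda>j l. h j (_ j # l)"])
  finally show ?case by simp
qed simp

text \<open>Binomial theorem, since 2^j (1 / 2^j)^n is the j-th power of 2 (1/2)^n, the probability
  that n >= 1 fair bits coincide.\<close>

lemma hull_U_eq: "hull_U n d = 1 - (1 - 2 * (1 / 2) ^ n) ^ d"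
proof -
  let ?t = "2 * (1 / 2) ^ n :: real"
  have "(1 - ?t) ^ d = (\<Sum>k\<le>d. real (d choose k) * (- ?t) ^ k)"
    by (subst binomial_ring[of "- ?t" 1 d, simplified power_one mult_1_right, symmetric]) simp
  also have "\<dots> = 1 + (\<Sum>k=1..d. real (d choose k) * (- ?t) ^ k)"
  proof -
    have "{..d} = insert 0 {1..d}" by auto
    then show ?thesis by simp
  qed
  also have "(\<Sum>k=1..d. real (d choose k) * (- ?t) ^ k) = - hull_U n d"
    unfolding hull_U_def sum_negf[symmetric]
  proof (rule sum.cong[OF refl])
    fix k assume "k \<in> {1..d}"
    then have "(- 1 :: real) ^ k = - ((- 1) ^ (k - 1))" by (cases k) auto
    then show "real (d choose k) * (- ?t) ^ k =
        - ((- 1) ^ (k - 1) * real (d choose k) * 2 ^ k * (1 / 2 ^ k) ^ n)"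
      unfolding power_minus[of ?t]
      by (simp only: power_mult_distrib power_one_over power_mult[symmetric] mult.commute[of n k])
         (simp add: mult.assoc)
  qed
  finally show ?thesis by simp
qed

lemma list_exp_const_coord_uniform:
  assumes "n \<ge> 1"
  shows "list_exp (\<lambda>_. 1 / 2 ^ CARD('d)) n (\<lambda>l :: ('d::finite \<Rightarrow> bool) list. of_bool (const_coord l))
    = hull_U n CARD('d)"
proof -
  \<comment> \<open>On a nonempty list the all-True and all-False events exclude each other, so
    \<open>?h\<close> indicates that both values occur. On the empty list it would be -1, which is
    where \<open>n \<ge> 1\<close> enters.\<close>
  let ?h = "\<lambda>l. 1 - (of_bool (\<forall>b\<in>set l. b \<in> {True}) + of_bool (\<forall>b\<in>set l. b \<in> {False})) :: real"
  have c: "of_bool (const_coord l) = 1 - (\<Prod>j\<in>UNIV. ?h (map (\<lambda>x. x j) l))"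
    if l: "length l = n" for l :: "('d \<Rightarrow> bool) list"
  proof (cases "const_coord l")
    case True
    then obtain j s where js: "\<forall>x\<in>set l. x j = s" by (auto simp: const_coord_def)
    have "l \<noteq> []" using l assms by auto
    then obtain y where "y \<in> set l" by (cases l) auto
    with js have "?h (map (\<lambda>x. x j) l) = 0" by (cases s) auto
    then have "(\<Prod>j\<in>UNIV. ?h (map (\<lambda>x. x j) l)) = 0"
      by (intro prod_zero bexI[of _ j]) simp_all
    then show ?thesis using True by simp
  next
    case False
    then have "\<not> (\<forall>x\<in>set l. x j = s)" for j s unfolding const_coord_def by blast
    from this[of _ True] this[of _ False] have "?h (map (\<lambda>x. x j) l) = 1" for j by simp
    then have "(\<Prod>j\<in>UNIV. ?h (map (\<lambda>x. x j) l)) = 1" by (intro prod.neutral) blast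
    then show ?thesis using False by simp
  qed
  have h: "list_exp (\<lambda>_. 1 / 2) n ?h = 1 - 2 * (1 / 2) ^ n"
    unfolding list_exp_diff list_exp_add list_exp_all by (simp add: list_exp_const)
  have "list_exp (\<lambda>_. 1 / 2 ^ CARD('d)) n (\<lambda>l :: ('d \<Rightarrow> bool) list. of_bool (const_coord l)) =
      list_exp (\<lambda>_. 1 / 2 ^ CARD('d)) n (\<lambda>l. 1 - (\<Prod>j\<in>(UNIV :: 'd set). ?h (map (\<lambda>x. x j) l)))"
    by (rule list_exp_cong) (rule c)
  also have "\<dots> = 1 - (1 - 2 * (1 / 2) ^ n) ^ CARD('d)"
    unfolding list_exp_diff[of "\<lambda>_. 1 / 2 ^ CARD('d)"] list_exp_prod[of n "\<lambda>_. ?h"] h by (simp add: list_exp_const card_fun)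
  finally show ?thesis by (simp add: hull_U_eq)
qed

section \<open>Power sums near the uniform distribution\<close>

text \<open>The remainder is nonnegative by convexity, and the second derivative of the power is at
  most n (n - 1) on [0, 1]. The induction uses R (n + 1) = p R n + n u^(n - 1) (p - u)^2 instead of
  calculus.\<close>

lemma power_taylor_bounds:
  fixes p u :: real
  assumes "0 \<le> p" "p \<le> 1" "0 \<le> u" "u \<le> 1"
  shows "0 \<le> p ^ n - u ^ n - real n * u ^ (n - 1) * (p - u)"
    "p ^ n - u ^ n - real n * u ^ (n - 1) * (p - u) \<le> real n * (real n - 1) / 2 * (p - u)\<^sup>2"
proof -
  let ?R = "\<lambda>n. p ^ n - u ^ n - real n * u ^ (n - 1) * (p - u)"
  have "0 \<le> ?R n \<and> ?R n \<le> real n * (real n - 1) / 2 * (p - u)\<^sup>2"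
  proof (induction n)
    case (Suc n)
    have "?R (Suc n) = p * ?R n + real n * u ^ (n - 1) * (p - u)\<^sup>2"
      by (cases n) (simp_all add: algebra_simps power2_eq_square)
    moreover have "0 \<le> p * ?R n" "p * ?R n \<le> 1 * ?R n"
      using Suc assms mult_nonneg_nonneg[of p "?R n"] mult_right_mono[of p 1 "?R n"] by blast+
    moreover have "0 \<le> real n * u ^ (n - 1) * (p - u)\<^sup>2"
      using assms by auto
    moreover have "real n * u ^ (n - 1) * (p - u)\<^sup>2 \<le> real n * 1 * (p - u)\<^sup>2"
      using assms by (intro mult_right_mono mult_left_mono power_le_one) auto
    ultimately show ?case using Suc by (simp add: field_simps)
  qed simp
  then show "0 \<le> ?R n" "?R n \<le> real n * (real n - 1) / 2 * (p - u)\<^sup>2" by auto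
qed

text \<open>Summing the Taylor bounds kills the linear term, as the deviations from 1/N add up to
  zero. They lie in [- a, (N - 1) a], and the bound on their squares is attained when one is (N - 1)
  a and all others are - a.\<close>

lemma sum_power_bounds:
  fixes p :: "'h::finite \<Rightarrow> real"
  assumes p: "\<And>x. p x \<ge> 0" "sum p UNIV = 1" and a: "\<And>x. p x \<ge> 1 / real CARD('h) - a"
  defines "N \<equiv> real CARD('h)"
  shows "(\<Sum>x\<in>UNIV. (p x) ^ n) \<ge> (\<Sum>x\<in>(UNIV::'h set). (1 / N) ^ n)"
    "(\<Sum>x\<in>UNIV. (p x) ^ n) - (\<Sum>x\<in>(UNIV::'h set). (1 / N) ^ n)
       \<le> real n * (real n - 1) / 2 * (N * (N - 1) * a\<^sup>2)"
proof -
  have N: "N \<ge> 1" unfolding N_def using finite_UNIV_card_ge_0[where 'a = 'h] by simp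
  have s0: "(\<Sum>x\<in>UNIV. p x - 1 / N) = 0"
    using N by (simp add: sum_subtractf p N_def)
  have p1: "p x \<le> 1" for x
    using member_le_sum[of x UNIV p] p by auto
  let ?R = "\<lambda>x. (p x) ^ n - (1 / N) ^ n - real n * (1 / N) ^ (n - 1) * (p x - 1 / N)"
  have "(\<Sum>x\<in>UNIV. ?R x) = (\<Sum>x\<in>UNIV. (p x) ^ n) - (\<Sum>x\<in>(UNIV::'h set). (1 / N) ^ n)
       - real n * (1 / N) ^ (n - 1) * (\<Sum>x\<in>UNIV. p x - 1 / N)"
    unfolding sum_subtractf sum_distrib_left[symmetric] ..
  then have R: "(\<Sum>x\<in>UNIV. (p x) ^ n) - (\<Sum>x\<in>(UNIV::'h set). (1 / N) ^ n) = (\<Sum>x\<in>UNIV. ?R x)"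
    unfolding s0 by simp
  have b: "0 \<le> ?R x" "?R x \<le> real n * (real n - 1) / 2 * (p x - 1 / N)\<^sup>2" for x
    using power_taylor_bounds[of "p x" "1 / N" n] p p1[of x] N by auto
  have "0 \<le> (\<Sum>x\<in>UNIV. ?R x)" by (intro sum_nonneg b)
  then show "(\<Sum>x\<in>UNIV. (p x) ^ n) \<ge> (\<Sum>x\<in>(UNIV::'h set). (1 / N) ^ n)" using R by simp
  have low: "- a \<le> p x - 1 / N" for x using a[of x] unfolding N_def by linarith
  have up: "p x - 1 / N \<le> (N - 1) * a" for x
  proof -
    have "(\<Sum>y\<in>UNIV. p y - 1 / N) = (p x - 1 / N) + (\<Sum>y\<in>UNIV - {x}. p y - 1 / N)"
      by (simp add: sum.remove)
    moreover have "(\<Sum>y\<in>UNIV - {x}. p y - 1 / N) \<ge> (\<Sum>y\<in>UNIV - {x}. - a)"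
      by (intro sum_mono low)
    moreover have "(\<Sum>y\<in>UNIV - {x}. - a) = - ((N - 1) * a)"
      using N by (simp add: card_Diff_singleton N_def of_nat_diff)
    ultimately show ?thesis using s0 by linarith
  qed
  \<comment> \<open>On [- a, (N - 1) a] the square lies below its chord, whose linear part cancels
    in the sum over \<open>x\<close>.\<close>
  have "(p x - 1 / N)\<^sup>2 \<le> (N - 2) * a * (p x - 1 / N) + (N - 1) * a\<^sup>2" for x
  proof -
    have "(p x - 1 / N + a) * ((N - 1) * a - (p x - 1 / N)) \<ge> 0"
      using low[of x] up[of x] by (intro mult_nonneg_nonneg) auto
    then show ?thesis by (simp add: algebra_simps power2_eq_square)
  qed
  then have "(\<Sum>x\<in>UNIV. (p x - 1 / N)\<^sup>2) \<le> (\<Sum>x\<in>UNIV. (N - 2) * a * (p x - 1 / N) + (N - 1) * a\<^sup>2)"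
    by (intro sum_mono)
  also have "\<dots> = (N - 2) * a * (\<Sum>x\<in>UNIV. p x - 1 / N) + N * (N - 1) * a\<^sup>2"
    unfolding sum.distrib sum_distrib_left[symmetric] by (simp add: N_def)
  finally have sq: "(\<Sum>x\<in>UNIV. (p x - 1 / N)\<^sup>2) \<le> N * (N - 1) * a\<^sup>2" using s0 by simp
  have "(\<Sum>x\<in>UNIV. ?R x) \<le> real n * (real n - 1) / 2 * (\<Sum>x\<in>UNIV. (p x - 1 / N)\<^sup>2)"
    unfolding sum_distrib_left by (intro sum_mono b)
  also have "\<dots> \<le> real n * (real n - 1) / 2 * (N * (N - 1) * a\<^sup>2)"
  proof (intro mult_left_mono sq)
    show "0 \<le> real n * (real n - 1) / 2" by (cases n) auto
  qed
  finally show "(\<Sum>x\<in>UNIV. (p x) ^ n) - (\<Sum>x\<in>(UNIV::'h set). (1 / N) ^ n)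
       \<le> real n * (real n - 1) / 2 * (N * (N - 1) * a\<^sup>2)" using R by simp
qed


section \<open>Miss probability of sign vectors under a one-sided bound on their law\<close>

text \<open>With zero total mass the l1 norm is twice the sum of the negative parts. Each of these
  is at most \<open>a\<close>, and some point has none, whence N - 1 instead of N.\<close>

lemma sum_abs_le_of_lower_bound:
  fixes e :: "'h::finite \<Rightarrow> real"
  assumes "sum e UNIV = 0" "\<And>x. e x \<ge> - a"
  shows "(\<Sum>x\<in>UNIV. \<bar>e x\<bar>) \<le> 2 * (real CARD('h) - 1) * a"
proof -
  have "\<exists>x. e x \<ge> 0"
  proof (rule ccontr)
    assume "\<nexists>x. e x \<ge> 0"
    then have "sum e UNIV < (\<Sum>x\<in>(UNIV :: 'h set). 0)" by (intro sum_strict_mono) (auto simp: not_le)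
    then show False using assms(1) by simp
  qed
  then obtain y where y: "e y \<ge> 0" by blast
  have "(\<Sum>x\<in>UNIV. \<bar>e x\<bar>) = (\<Sum>x\<in>UNIV. \<bar>e x\<bar> - e x)"
    using assms(1) by (simp add: sum_subtractf)
  also have "\<dots> = (\<Sum>x\<in>UNIV - {y}. \<bar>e x\<bar> - e x)"
    using y by (subst sum.remove[of _ y]) auto
  also have "\<dots> \<le> (\<Sum>x\<in>UNIV - {y}. 2 * a)"
  proof (rule sum_mono)
    \<comment> \<open>At points with \<open>e x \<ge> 0\<close> the claim reads 0 <= 2 a, so the
      sign of \<open>a\<close> has to be extracted from the hypotheses.\<close>
    have "0 \<le> a" if "e z < 0" for z using assms(2)[of z] that by linarith
    moreover have "0 \<le> a"
    proof (cases "\<exists>z. e z < 0")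
      case False
      then have "\<forall>z. e z = 0" using assms(1) by (simp add: sum_nonneg_eq_0_iff not_less)
      then show ?thesis using assms(2)[of y] by simp
    qed (use calculation in blast)
    ultimately show "\<bar>e x\<bar> - e x \<le> 2 * a" for x using assms(2)[of x] by (auto simp: abs_if)
  qed
  also have "\<dots> = 2 * (real CARD('h) - 1) * a"
    using finite_UNIV_card_ge_0[where 'a = 'h] by (simp add: card_Diff_singleton of_nat_diff)
  finally show ?thesis .
qed

text \<open>The general argument loses a factor slightly larger than one when \<open>d = 2\<close>; inclusion-exclusion
  over the two coordinates does not.\<close>

lemma list_exp_const_coord_card_2:
  fixes p :: "('d::finite \<Rightarrow> bool) \<Rightarrow> real"
  assumes ij: "(UNIV :: 'd set) = {i, j}" "i \<noteq> j" and n: "n \<ge> 1"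
  shows "list_exp p n (\<lambda>l. of_bool (const_coord l)) =
    (\<Sum>s\<in>UNIV. (\<Sum>x | x i = s. p x) ^ n) + (\<Sum>s\<in>UNIV. (\<Sum>x | x j = s. p x) ^ n) - (\<Sum>x\<in>UNIV. p x ^ n)"
proof -
  let ?I = "\<lambda>K l. of_bool (\<forall>y\<in>set l. y \<in> K) :: real"
  \<comment> \<open>Inclusion-exclusion on indicators: the first two sums test whether coordinate
    \<open>i\<close> or \<open>j\<close> is constant, the last whether both are, that is, whether
    all vectors coincide. Nonemptiness makes exactly one candidate value count in each sum.\<close>
  let ?g = "\<lambda>l. (\<Sum>s\<in>UNIV. ?I {x. x i = s} l) + (\<Sum>s\<in>UNIV. ?I {x. x j = s} l) - (\<Sum>x\<in>UNIV. ?I {x} l)"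
  have g: "of_bool (const_coord l) = ?g l" if l: "length l = n" for l
  proof -
    obtain y l' where y: "l = y # l'" using l n by (cases l) auto
    have 1: "(\<Sum>s\<in>UNIV. ?I {x. x k = s} l) = of_bool (\<forall>x\<in>set l. x k = y k)" for k
    proof -
      have "(\<Sum>s\<in>UNIV. ?I {x. x k = s} l) = (\<Sum>s\<in>UNIV. if s = y k then of_bool (\<forall>x\<in>set l. x k = y k) else 0)"
        by (intro sum.cong) (auto simp: y)
      then show ?thesis by simp
    qed
    have 2: "(\<Sum>x\<in>UNIV. ?I {x} l) = of_bool (\<forall>x\<in>set l. x = y)"
    proof -
      have "(\<Sum>x\<in>UNIV. ?I {x} l) = (\<Sum>x\<in>UNIV. if x = y then of_bool (\<forall>x\<in>set l. x = y) else 0)"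
        by (intro sum.cong) (auto simp: y)
      then show ?thesis by simp
    qed
    have k: "k = i \<or> k = j" for k using ij(1) by blast
    have ex: "(\<exists>k. Q k) \<longleftrightarrow> Q i \<or> Q j" for Q using k by metis
    have "x = y \<longleftrightarrow> x i = y i \<and> x j = y j" for x
    proof
      assume "x i = y i \<and> x j = y j"
      then have "x k = y k" for k using k[of k] by auto
      then show "x = y" by (rule ext)
    qed simp
    then have 3: "(\<forall>x\<in>set l. x = y) \<longleftrightarrow> (\<forall>x\<in>set l. x i = y i) \<and> (\<forall>x\<in>set l. x j = y j)"
      by (simp only: ball_conj_distrib)
    have "const_coord l \<longleftrightarrow> (\<exists>k. \<forall>x\<in>set l. x k = y k)"
      unfolding const_coord_def y by simp
    also have "\<dots> \<longleftrightarrow> (\<forall>x\<in>set l. x i = y i) \<or> (\<forall>x\<in>set l. x j = y j)"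
      by (rule ex)
    finally show ?thesis unfolding 1 2 3 by (simp only:) (simp add: of_bool_def)
  qed
  have sum: "list_exp p n (\<lambda>l. \<Sum>s\<in>T. F s l) = (\<Sum>s\<in>T. list_exp p n (F s))"
    for F :: "'s \<Rightarrow> _ \<Rightarrow> real" and T
  proof -
    have "list_exp p n (\<lambda>l. \<Sum>s\<in>T. F s l) = (\<Sum>l | length l = n. \<Sum>s\<in>T. prod_list (map p l) * F s l)"
      unfolding list_exp_eq_sum by (simp only: sum_distrib_left)
    also have "\<dots> = (\<Sum>s\<in>T. \<Sum>l | length l = n. prod_list (map p l) * F s l)"
      by (rule sum.swap)
    finally show ?thesis unfolding list_exp_eq_sum .
  qed
  let ?A = "\<lambda>k l. \<Sum>s\<in>UNIV. ?I {x. x k = s} l" and ?C = "\<lambda>l. \<Sum>x\<in>UNIV. ?I {x} l"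
  have A: "list_exp p n (?A k) = (\<Sum>s\<in>UNIV. (\<Sum>x | x k = s. p x) ^ n)" for k
    by (rule trans[OF sum sum.cong[OF refl list_exp_all]])
  have C: "list_exp p n ?C = (\<Sum>x\<in>UNIV. (\<Sum>y\<in>{x}. p y) ^ n)"
    by (rule trans[OF sum sum.cong[OF refl list_exp_all]])
  have "list_exp p n (\<lambda>l. of_bool (const_coord l)) = list_exp p n ?g"
    by (rule list_exp_cong) (rule g)
  also have "\<dots> = list_exp p n (\<lambda>l. ?A i l + ?A j l) - list_exp p n ?C" by (rule list_exp_diff)
  also have "list_exp p n (\<lambda>l. ?A i l + ?A j l) = list_exp p n (?A i) + list_exp p n (?A j)"
    by (rule list_exp_add)
  finally show ?thesis unfolding A C by simp
qed

lemma list_exp_const_coord_approx: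
  fixes p :: "('d::finite \<Rightarrow> bool) \<Rightarrow> real"
  assumes p: "\<And>x. p x \<ge> 0" "sum p UNIV = 1"
    and low: "\<And>x. p x \<ge> 1 / 2 ^ CARD('d) - \<delta> / 2 ^ (CARD('d) - 1)"
    and \<delta>: "\<delta> \<ge> 0" and n: "n \<ge> 1"
  shows "\<bar>list_exp p n (\<lambda>l. of_bool (const_coord l)) - hull_U n CARD('d)\<bar>
    \<le> 2 ^ (CARD('d) - 1) * (real n * (real n - 1)) * \<delta>\<^sup>2"
proof (cases "CARD('d) = 2")
  case False
  define d where "d = CARD('d)"
  define N where "N = (2 :: real) ^ d"
  \<comment> \<open>The shortfall \<delta> / 2^(d - 1) allowed by \<open>low\<close> equals 2
    \<delta> / N.\<close>
  define s where "s = (N - 1) * (2 * \<delta> / N)"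
  have d: "d \<ge> 1" unfolding d_def using finite_UNIV_card_ge_0[where 'a = 'd] by simp
  have N: "N \<ge> 2" unfolding N_def using power_increasing[OF d, of "2::real"] by simp
  have cN: "real CARD('d \<Rightarrow> bool) = N" by (simp add: card_fun N_def d_def)
  have half: "(2::real) ^ (d - 1) = N / 2" unfolding N_def using d by (cases d) auto
  have z: "(\<Sum>x\<in>UNIV. p x - 1 / N) = 0" using N by (simp add: sum_subtractf p(2) cN)
  have "- (2 * \<delta> / N) \<le> p x - 1 / N" for x
    using low[of x] unfolding d_def[symmetric] N_def[symmetric] half by (simp add: mult.commute)
  from sum_abs_le_of_lower_bound[OF z this]
  have s: "(\<Sum>x\<in>UNIV. \<bar>p x - 1 / N\<bar>) \<le> 2 * s"
    by (simp only: cN s_def mult.assoc)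
  have u: "(\<Sum>x\<in>(UNIV :: ('d \<Rightarrow> bool) set). 1 / N) = 1" using N by (simp add: cN)
  let ?f = "\<lambda>l :: ('d \<Rightarrow> bool) list. of_bool (const_coord l) :: real"
  have "\<bar>list_exp p n ?f - list_exp (\<lambda>_. 1 / N) n ?f
      - list_exp_deriv (\<lambda>_. 1 / N) (\<lambda>x. p x - 1 / N) n ?f\<bar>
      \<le> real n * (real n - 1) * s\<^sup>2"
    using N by (intro list_exp_taylor[where q = "\<lambda>_. 1 / N"] p s u) auto
  moreover have "list_exp_deriv (\<lambda>_. 1 / N) (\<lambda>x. p x - 1 / N) n ?f = 0"
    by (intro list_exp_deriv_eq_0 z) (simp only: const_coord_translate)
  ultimately have first: "\<bar>list_exp p n (\<lambda>l. of_bool (const_coord l)) - hull_U n d\<bar>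
      \<le> real n * (real n - 1) * s\<^sup>2"
    using list_exp_const_coord_uniform[OF n, where 'd = 'd] by (simp add: N_def d_def)
  have "s\<^sup>2 \<le> 2 ^ (d - 1) * \<delta>\<^sup>2"
  proof (cases "d = 1")
    case True
    then show ?thesis by (simp add: s_def N_def)
  next
    case 1: False
    \<comment> \<open>With d = 1 and d = 2 excluded, N >= 8, and the factor 4 from
      \<open>s \<le> 2 * \<delta>\<close> fits below N / 2 = 2^(d - 1).\<close>
    then have "d \<ge> 3" using False[folded d_def] d by linarith
    then have "(2::real) ^ 3 \<le> N" unfolding N_def by (intro power_increasing) auto
    then have "4 * \<delta>\<^sup>2 \<le> N / 2 * \<delta>\<^sup>2" by (intro mult_right_mono) auto
    moreover have "s = 2 * \<delta> - 2 * \<delta> / N" using N by (simp add: s_def field_simps)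
    then have "s \<le> 2 * \<delta>" using \<delta> N by simp
    then have "s\<^sup>2 \<le> (2 * \<delta>)\<^sup>2" using \<delta> N by (intro power_mono) (auto simp: s_def)
    ultimately show ?thesis unfolding half by (simp add: power_mult_distrib)
  qed
  then have "real n * (real n - 1) * s\<^sup>2 \<le> real n * (real n - 1) * (2 ^ (d - 1) * \<delta>\<^sup>2)"
    using n by (intro mult_left_mono) auto
  also have "\<dots> = 2 ^ (d - 1) * (real n * (real n - 1)) * \<delta>\<^sup>2" by (simp only: mult_ac)
  finally show ?thesis using first unfolding d_def by linarith
next
  case True
  then obtain i j where ij: "(UNIV :: 'd set) = {i, j}" "i \<noteq> j" by (auto simp: card_2_iff)
  define m where "m = (\<lambda>(q :: ('d \<Rightarrow> bool) \<Rightarrow> real) k s. \<Sum>x | x k = s. q x)"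
  \<comment> \<open>The coefficient in \<open>sum_power_bounds\<close>; the target for d = 2 is 4 c
    \<delta>^2.\<close>
  define c where "c = real n * (real n - 1) / 2"
  have c4: "real CARD('d \<Rightarrow> bool) = 4" by (simp add: card_fun True)
  have half: "card {x :: 'd \<Rightarrow> bool. x k = s} = 2" for k s
  proof -
    let ?n = "\<lambda>x :: 'd \<Rightarrow> bool. x(k := \<not> x k)"
    have "card {x :: 'd \<Rightarrow> bool. x k = s} = card {x :: 'd \<Rightarrow> bool. x k = (\<not> s)}"
      by (rule bij_betw_same_card[of ?n], rule bij_betw_byWitness[of _ ?n]) (auto simp: fun_upd_idem)
    moreover have "card {x :: 'd \<Rightarrow> bool. x k = s} + card {x :: 'd \<Rightarrow> bool. x k = (\<not> s)}
        = card (UNIV :: ('d \<Rightarrow> bool) set)"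
      by (subst card_Un_disjoint[symmetric]) (auto intro: arg_cong[where f = card])
    ultimately show ?thesis using c4 by simp
  qed
  have msum: "sum (m p k) UNIV = 1" for k
  proof -
    have "sum (m p k) UNIV = (\<Sum>s\<in>UNIV. \<Sum>x\<in>{x\<in>UNIV. x k = s}. p x)" by (simp add: m_def)
    also have "\<dots> = 1" using p(2) by (subst sum.group) auto
    finally show ?thesis .
  qed
  \<comment> \<open>A marginal collects two sign vectors, each with shortfall at most \<delta> /
    2.\<close>
  have mlow: "m p k s \<ge> 1 / real CARD(bool) - \<delta>" for k s
  proof -
    have "(\<Sum>x | x k = s. 1 / 4 - \<delta> / 2) \<le> m p k s"
      unfolding m_def using low True by (intro sum_mono) auto
    then show ?thesis using half by simp
  qed
  have m0: "m p k s \<ge> 0" for k s unfolding m_def by (intro sum_nonneg p)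
  have mu: "m (\<lambda>_. 1 / 4) k s = 1 / 2" for k s using half by (simp add: m_def)
  \<comment> \<open>N (N - 1) a^2 is 2 \<delta>^2 for a marginal (N = 2, a = \<delta>), and 3
    \<delta>^2 for the joint law below (N = 4, a = \<delta> / 2).\<close>
  have mb: "0 \<le> (\<Sum>s\<in>UNIV. m p k s ^ n) - (\<Sum>s\<in>(UNIV :: bool set). (1 / 2) ^ n)"
      "(\<Sum>s\<in>UNIV. m p k s ^ n) - (\<Sum>s\<in>(UNIV :: bool set). (1 / 2) ^ n) \<le> c * (2 * \<delta>\<^sup>2)" for k
    using sum_power_bounds[OF m0[of k] msum mlow, of n] by (simp_all add: c_def)
  have pb: "0 \<le> (\<Sum>x\<in>UNIV. p x ^ n) - (\<Sum>x\<in>(UNIV :: ('d \<Rightarrow> bool) set). (1 / 4) ^ n)"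
      "(\<Sum>x\<in>UNIV. p x ^ n) - (\<Sum>x\<in>(UNIV :: ('d \<Rightarrow> bool) set). (1 / 4) ^ n) \<le> c * (3 * \<delta>\<^sup>2)"
    using sum_power_bounds[where n = n and a = "\<delta> / 2", OF p] low by (simp_all add: c4 True c_def power_divide)
  have F: "list_exp q n (\<lambda>l. of_bool (const_coord l)) =
      (\<Sum>s\<in>UNIV. m q i s ^ n) + (\<Sum>s\<in>UNIV. m q j s ^ n) - (\<Sum>x\<in>UNIV. q x ^ n)" for q
    using list_exp_const_coord_card_2[OF ij n, of q] by (simp add: m_def)
  have U: "hull_U n CARD('d) = list_exp (\<lambda>_. 1 / 4) n (\<lambda>l :: ('d \<Rightarrow> bool) list. of_bool (const_coord l))"
    using list_exp_const_coord_uniform[OF n, where 'd = 'd] True by simp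
  \<comment> \<open>All three increments are nonnegative and the joint one is subtracted, so the
    difference lies between - 3 c \<delta>^2 and (2 + 2) c \<delta>^2.\<close>
  have "\<bar>list_exp p n (\<lambda>l. of_bool (const_coord l)) - hull_U n CARD('d)\<bar> \<le> c * (4 * \<delta>\<^sup>2)"
  proof -
    have "0 \<le> c * \<delta>\<^sup>2" using n by (simp add: c_def)
    then show ?thesis unfolding U F mu using mb[of i] mb[of j] pb by (simp add: abs_if)
  qed
  then show ?thesis by (simp add: True c_def algebra_simps)
qed

section \<open>The number of batches\<close>

text \<open>With r = (1 - \<alpha>)^(1/d) and n >= 1, the closed form of \<open>hull_U\<close> makes
  \<open>hull_U n d \<le> \<alpha>\<close> equivalent to 2^(1 - n) <= 1 - r, that is, to n >= 1 -
  log 2 (1 - r). The ceiling is the least such integer.\<close>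

lemma hull_B_bounds:
  assumes \<alpha>: "0 < \<alpha>" "\<alpha> < 1" and d: "d \<ge> 1"
  shows "2 \<le> hull_B \<alpha> d" "hull_U (hull_B \<alpha> d) d \<le> \<alpha>" "\<alpha> < hull_U (hull_B \<alpha> d - 1) d"
proof -
  define r where "r = (1 - \<alpha>) powr (1 / real d)"
  define B where "B = hull_B \<alpha> d"
  have r: "0 < r" "r < 1" using \<alpha> d powr_less_mono2[of "1 / real d" "1 - \<alpha>" 1] by (auto simp: r_def)
  have rd: "r ^ d = 1 - \<alpha>"
    using \<alpha> d r by (simp add: r_def powr_powr flip: powr_realpow)
  have L: "log 2 (1 - r) < 0" using r by simp
  have B: "real B = of_int \<lceil>1 - log 2 (1 - r)\<rceil>"
    using L unfolding B_def hull_B_def r_def[symmetric] by (simp add: of_nat_nat ceiling_le_iff)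
  have B1: "1 - log 2 (1 - r) \<le> real B" "real B < 2 - log 2 (1 - r)"
    unfolding B by (rule le_of_int_ceiling) (use ceiling_correct[of "1 - log 2 (1 - r)"] in linarith)
  then have "1 < real B" using L by linarith
  then show B2: "2 \<le> hull_B \<alpha> d" by (simp add: B_def)
  have pw: "2 * (1 / 2) ^ n = (2::real) powr (1 - real n)" for n
    by (simp add: powr_diff powr_realpow power_one_over)
  have "2 powr (1 - real B) \<le> 1 - r"
    using B1 r by (subst le_log_iff[symmetric]) auto
  then have "r ^ d \<le> (1 - 2 * (1 / 2) ^ B) ^ d"
    using r by (intro power_mono) (auto simp: pw)
  then show "hull_U (hull_B \<alpha> d) d \<le> \<alpha>" by (simp add: hull_U_eq rd B_def)
  have "1 - r < 2 powr (1 - real (B - 1))"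
    using B1 r B2 by (subst log_less_iff[symmetric]) (auto simp: B_def of_nat_diff)
  \<comment> \<open>This keeps the base 1 - 2 (1/2)^(B - 1) nonnegative, without which its d-th
    power need not be monotone; it relies on B - 1 >= 1.\<close>
  moreover have "2 powr (1 - real (B - 1)) \<le> (2::real) powr 0"
    using B2 by (intro powr_mono) (auto simp: B_def)
  ultimately have "(1 - 2 * (1 / 2) ^ (B - 1)) ^ d < r ^ d"
    unfolding pw using d by (intro power_strict_mono) auto
  then show "\<alpha> < hull_U (hull_B \<alpha> d - 1) d" by (simp add: hull_U_eq rd B_def)
qed

lemma hull_tau_bounds:
  assumes \<alpha>: "0 < \<alpha>" "\<alpha> < 1" and d: "d \<ge> 1"
  shows "0 \<le> hull_tau \<alpha> d" "hull_tau \<alpha> d \<le> 1"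
    "hull_tau \<alpha> d * hull_U (hull_B \<alpha> d - 1) d + (1 - hull_tau \<alpha> d) * hull_U (hull_B \<alpha> d) d = \<alpha>"
proof -
  note b = hull_B_bounds[OF assms]
  show "0 \<le> hull_tau \<alpha> d" "hull_tau \<alpha> d \<le> 1" using b by (auto simp: hull_tau_def divide_simps)
  have "hull_tau \<alpha> d * (hull_U (hull_B \<alpha> d - 1) d - hull_U (hull_B \<alpha> d) d) = \<alpha> - hull_U (hull_B \<alpha> d) d"
    using b by (simp add: hull_tau_def)
  then show "hull_tau \<alpha> d * hull_U (hull_B \<alpha> d - 1) d + (1 - hull_tau \<alpha> d) * hull_U (hull_B \<alpha> d) d = \<alpha>"
    by (simp add: algebra_simps)
qed

section \<open>Independence of data and split\<close>

text \<open>The bridge from independent random variables to finite sums: the event splits according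
  to the complete list of values, and each list has product probability.\<close>

lemma (in prob_space) prob_indep_list:
  fixes Z :: "nat \<Rightarrow> 'a \<Rightarrow> 'h::finite"
  assumes ind: "indep_vars (\<lambda>_. count_space UNIV) Z {1..n}" and n: "n \<ge> 1"
    and p: "\<And>k x. k \<in> {1..n} \<Longrightarrow> prob {\<omega> \<in> space M. Z k \<omega> = x} = p x"
  shows "{\<omega> \<in> space M. Q (map (\<lambda>k. Z k \<omega>) [1..<Suc n])} \<in> events"
    and "prob {\<omega> \<in> space M. Q (map (\<lambda>k. Z k \<omega>) [1..<Suc n])} = list_exp p n (\<lambda>l. of_bool (Q l))"
proof -
  let ?L = "{l :: 'h list. length l = n}" and ?Z = "\<lambda>\<omega>. map (\<lambda>k. Z k \<omega>) [1..<Suc n]"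
  let ?E = "\<lambda>l. {\<omega> \<in> space M. ?Z \<omega> = l}"
  have finL: "finite ?L" using finite_lists_length_eq[of "UNIV :: 'h set" n] by simp
  have E: "?E l = (\<Inter>k\<in>{1..n}. Z k -` {l ! (k - 1)} \<inter> space M)" if "length l = n" for l
  proof -
    have "?Z \<omega> = l \<longleftrightarrow> (\<forall>k\<in>Suc ` {..<n}. Z k \<omega> = l ! (k - 1))" for \<omega>
      unfolding list_eq_iff_nth_eq using that by (auto simp del: upt_Suc)
    then have "?Z \<omega> = l \<longleftrightarrow> (\<forall>k\<in>{1..n}. Z k \<omega> = l ! (k - 1))" for \<omega>
      unfolding image_Suc_lessThan .
    then show ?thesis using n by auto
  qed
  have pE: "prob (?E l) = prod_list (map p l)" if l: "length l = n" for l
  proof -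
    have "prob (?E l) = (\<Prod>k\<in>{1..n}. prob (Z k -` {l ! (k - 1)} \<inter> space M))"
      unfolding E[OF l] using n by (intro indep_varsD[OF ind]) auto
    also have "\<dots> = (\<Prod>k\<in>{1..n}. p (l ! (k - 1)))"
      using p by (intro prod.cong refl) (simp add: vimage_def Int_def conj_commute)
    also have "\<dots> = (\<Prod>k\<in>{0..<n}. p (l ! k))"
      by (rule prod.reindex_bij_witness[of _ Suc "\<lambda>k. k - 1"]) auto
    finally show ?thesis using l by (simp add: prod.list_conv_set_nth)
  qed
  have sE: "?E l \<in> events" if "length l = n" for l
    unfolding E[OF that] using ind n
    by (intro sets.finite_INT measurable_sets[where A = "count_space UNIV"]) (auto simp: indep_vars_def)
  have eq: "{\<omega> \<in> space M. Q (?Z \<omega>)} = (\<Union>l\<in>{l\<in>?L. Q l}. ?E l)" by auto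
  show "{\<omega> \<in> space M. Q (?Z \<omega>)} \<in> events"
    unfolding eq by (rule sets.finite_UN) (use finL sE in auto)
  from eq have "prob {\<omega> \<in> space M. Q (?Z \<omega>)} = (\<Sum>l\<in>{l\<in>?L. Q l}. prob (?E l))"
    using finL sE by (subst finite_measure_finite_Union[symmetric]) (auto simp: disjoint_family_on_def)
  also have "\<dots> = (\<Sum>l\<in>{l\<in>?L. Q l}. prod_list (map p l))" by (intro sum.cong refl pE) auto
  also have "\<dots> = list_exp p n (\<lambda>l. of_bool (Q l))"
    unfolding list_exp_eq_sum sum.inter_filter[OF finL] by (intro sum.cong refl) auto
  finally show "prob {\<omega> \<in> space M. Q (?Z \<omega>)} = list_exp p n (\<lambda>l. of_bool (Q l))" .
qed

lemma indep_rv_compose: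
  assumes M: "prob_space M" and ind: "indep_rv M N f K g" and h: "h \<in> measurable K L"
  shows "indep_rv M N f L (\<lambda>\<omega>. h (g \<omega>))"
proof -
  interpret prob_space M by (rule M)
  have g: "g \<in> measurable M K" using ind by (simp add: indep_rv_def)
  have eq: "(\<lambda>\<omega>. h (g \<omega>)) -` A \<inter> space M = g -` (h -` A \<inter> space K) \<inter> space M" for A
    using measurable_space[OF g] by (auto simp only: vimage_eq Int_iff)
  have sub: "{(\<lambda>\<omega>. h (g \<omega>)) -` A \<inter> space M | A. A \<in> sets L} \<subseteq> {g -` A \<inter> space M | A. A \<in> sets K}"
  proof
    fix b assume "b \<in> {(\<lambda>\<omega>. h (g \<omega>)) -` A \<inter> space M | A. A \<in> sets L}"
    then obtain A where A: "A \<in> sets L" "b = g -` (h -` A \<inter> space K) \<inter> space M"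
      unfolding eq by blast
    then show "b \<in> {g -` A \<inter> space M | A. A \<in> sets K}"
      using measurable_sets[OF h A(1)] by blast
  qed
  have f: "f \<in> measurable M N"
    and fg: "indep_set {f -` A \<inter> space M | A. A \<in> sets N} {g -` A \<inter> space M | A. A \<in> sets K}"
    using ind unfolding indep_rv_def by blast+
  have "indep_set {f -` A \<inter> space M | A. A \<in> sets N} {(\<lambda>\<omega>. h (g \<omega>)) -` A \<inter> space M | A. A \<in> sets L}"
    unfolding indep_sets2_eq
  proof (intro conjI ballI)
    show "{f -` A \<inter> space M | A. A \<in> sets N} \<subseteq> events" by (rule indep_setD_ev1[OF fg])
    show "{(\<lambda>\<omega>. h (g \<omega>)) -` A \<inter> space M | A. A \<in> sets L} \<subseteq> events"
      by (rule subset_trans[OF sub indep_setD_ev2[OF fg]])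
    fix a b
    assume "a \<in> {f -` A \<inter> space M | A. A \<in> sets N}"
      "b \<in> {(\<lambda>\<omega>. h (g \<omega>)) -` A \<inter> space M | A. A \<in> sets L}"
    then show "prob (a \<inter> b) = prob a * prob b" by (rule indep_setD[OF fg _ subsetD[OF sub]])
  qed
  then show ?thesis
    unfolding indep_rv_def using f measurable_compose[OF g h] by (intro conjI)
qed

text \<open>Law of total probability in finite form. The event for \<open>f\<close> may change with
  the cell \<open>G i\<close> that contains \<open>g\<close>, but its probability \<open>c\<close>
  does not. In the application a cell fixes the split and confines \<open>V\<close> to a
  set.\<close>

lemma prob_indep_mixture:
  assumes M: "prob_space M" and ind: "indep_rv M N f K g" and "finite I"
    and G: "\<And>i. i \<in> I \<Longrightarrow> G i \<in> sets K" "disjoint_family_on G I"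
    and A: "\<And>i. i \<in> I \<Longrightarrow> A i \<in> sets N"
    and c: "\<And>i. i \<in> I \<Longrightarrow> measure M {\<omega> \<in> space M. f \<omega> \<in> A i} = c"
  shows "{\<omega> \<in> space M. \<exists>i\<in>I. g \<omega> \<in> G i \<and> f \<omega> \<in> A i} \<in> sets M"
    and "measure M {\<omega> \<in> space M. \<exists>i\<in>I. g \<omega> \<in> G i \<and> f \<omega> \<in> A i}
    = c * measure M {\<omega> \<in> space M. \<exists>i\<in>I. g \<omega> \<in> G i}"
proof -
  interpret prob_space M by (rule M)
  have f: "f \<in> measurable M N" and g: "g \<in> measurable M K"
    and fg: "indep_set {f -` A \<inter> space M | A. A \<in> sets N} {g -` A \<inter> space M | A. A \<in> sets K}"
    using ind by (auto simp: indep_rv_def)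
  let ?F = "\<lambda>i. f -` A i \<inter> space M" and ?G = "\<lambda>i. g -` G i \<inter> space M"
  have meas: "?F i \<in> events" "?G i \<in> events" if "i \<in> I" for i
    using measurable_sets[OF f A[OF that]] measurable_sets[OF g G(1)[OF that]] .
  have dis: "disjoint_family_on ?G I" "disjoint_family_on (\<lambda>i. ?F i \<inter> ?G i) I"
    using G(2) by (fastforce simp: disjoint_family_on_def)+
  have eq: "{\<omega> \<in> space M. \<exists>i\<in>I. g \<omega> \<in> G i \<and> f \<omega> \<in> A i} = (\<Union>i\<in>I. ?F i \<inter> ?G i)" by auto
  show "{\<omega> \<in> space M. \<exists>i\<in>I. g \<omega> \<in> G i \<and> f \<omega> \<in> A i} \<in> events"
    unfolding eq by (intro sets.finite_UN \<open>finite I\<close> sets.Int meas)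
  from eq have "prob {\<omega> \<in> space M. \<exists>i\<in>I. g \<omega> \<in> G i \<and> f \<omega> \<in> A i} = (\<Sum>i\<in>I. prob (?F i \<inter> ?G i))"
    using \<open>finite I\<close> meas dis by (simp add: finite_measure_finite_Union image_subset_iff)
  also have "\<dots> = (\<Sum>i\<in>I. c * prob (?G i))"
  proof (intro sum.cong refl)
    fix i assume i: "i \<in> I"
    have "prob (?F i) = c" using c[OF i] by (simp add: vimage_def Int_def conj_commute)
    then show "prob (?F i \<inter> ?G i) = c * prob (?G i)"
      using A[OF i] G(1)[OF i] by (subst indep_setD[OF fg]) auto
  qed
  also have "\<dots> = c * prob (\<Union>i\<in>I. ?G i)"
  proof -
    have "prob (\<Union>i\<in>I. ?G i) = (\<Sum>i\<in>I. prob (?G i))"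
      using meas by (intro finite_measure_finite_Union \<open>finite I\<close> dis) auto
    then show ?thesis by (simp only: sum_distrib_left)
  qed
  also have "(\<Union>i\<in>I. ?G i) = {\<omega> \<in> space M. \<exists>i\<in>I. g \<omega> \<in> G i}" by auto
  finally show "prob {\<omega> \<in> space M. \<exists>i\<in>I. g \<omega> \<in> G i \<and> f \<omega> \<in> A i}
    = c * prob {\<omega> \<in> space M. \<exists>i\<in>I. g \<omega> \<in> G i}" .
qed

text \<open>Measurability is assumed only for samples indexed by 1, ..., m. Reading off the
  coordinates listed in \<open>l\<close> is a measurable map onto such a sample.\<close>

lemma estimation_procedure_measurable:
  assumes "estimation_procedure P \<A>" and l: "set l \<subseteq> I"
  shows "(\<lambda>x. \<A> (map x l)) \<in> borel_measurable (\<Pi>\<^sub>M i\<in>I. P)"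
proof -
  let ?m = "length l"
  have in_l: "l ! (i - 1) \<in> I" if "i \<in> {1..?m}" for i using that l by (auto intro!: subsetD[OF l] nth_mem)
  have 1: "(\<lambda>x. \<lambda>i\<in>{1..?m}. x (l ! (i - 1))) \<in> measurable (\<Pi>\<^sub>M i\<in>I. P) (\<Pi>\<^sub>M i\<in>{1..?m}. P)"
    by (intro measurable_restrict measurable_component_singleton in_l)
  have 2: "(\<lambda>x. \<A> (map x [1..<Suc ?m])) \<in> borel_measurable (\<Pi>\<^sub>M i\<in>{1..?m}. P)"
    using assms(1) by (simp add: estimation_procedure_def)
  have eq: "map (\<lambda>i\<in>{1..?m}. x (l ! (i - 1))) [1..<Suc ?m] = map x l" for x
    by (rule nth_equalityI) (auto simp del: upt_Suc)
  show ?thesis using measurable_compose[OF 1 2] unfolding eq .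
qed

section \<open>Law of a batch estimator and geometry of the hull\<close>

text \<open>A reference law that refers to neither indices nor splits, so that it is common to all
  batches of size \<open>m\<close>.\<close>

definition sample_law :: "'x measure \<Rightarrow> ('x list \<Rightarrow> real ^ 'd::finite) \<Rightarrow> nat \<Rightarrow> (real ^ 'd) measure" where
  "sample_law P \<A> m = distr (\<Pi>\<^sub>M i\<in>{1..m}. P) borel (\<lambda>x. \<A> (map x [1..<Suc m]))"

lemma distr_subsample_estimator:
  assumes M: "prob_space M" and iid: "prob_space.indep_vars M (\<lambda>_. P) X I" "\<And>i. i \<in> I \<Longrightarrow> distr M P (X i) = P"
    and est: "estimation_procedure P \<A>"
    and l: "distinct l" "set l \<subseteq> I" "l \<noteq> []"
  shows "distr M borel (\<lambda>\<omega>. \<A> (map (\<lambda>i. X i \<omega>) l)) = sample_law P \<A> (length l)"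
proof -
  interpret prob_space M by (rule M)
  let ?m = "length l" and ?\<phi> = "\<lambda>i. l ! (i - 1)"
  have rv: "random_variable P (X i)" if "i \<in> I" for i using iid(1) that by (auto simp: indep_vars_def)
  have \<phi>: "?\<phi> i \<in> I" if "i \<in> {1..?m}" for i using that l by (auto intro!: subsetD[OF l(2)] nth_mem)
  \<comment> \<open>Independence is reindexed along \<open>l\<close> by grouping into singleton
    blocks, which are disjoint because \<open>l\<close> is distinct.\<close>
  have "indep_vars (\<lambda>j. PiM {?\<phi> j} (\<lambda>_. P)) (\<lambda>j \<omega>. restrict (\<lambda>i. X i \<omega>) {?\<phi> j}) {1..?m}"
    using \<phi> l(1) by (intro indep_vars_restrict[OF iid(1)])
      (auto simp: disjoint_family_on_def nth_eq_iff_index_eq)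
  then have "indep_vars (\<lambda>_. P) (\<lambda>j \<omega>. restrict (\<lambda>i. X i \<omega>) {?\<phi> j} (?\<phi> j)) {1..?m}"
    by (rule indep_vars_compose2) (rule measurable_component_singleton, simp)
  then have ind: "indep_vars (\<lambda>_. P) (\<lambda>j. X (?\<phi> j)) {1..?m}" by simp
  have "distr M (\<Pi>\<^sub>M i\<in>{1..?m}. P) (\<lambda>\<omega>. \<lambda>i\<in>{1..?m}. X (?\<phi> i) \<omega>) = (\<Pi>\<^sub>M i\<in>{1..?m}. distr M P (X (?\<phi> i)))"
    using ind l(3) \<phi> rv by (subst indep_vars_iff_distr_eq_PiM'[symmetric]) (auto simp: Suc_le_eq)
  also have "\<dots> = (\<Pi>\<^sub>M i\<in>{1..?m}. P)" by (rule PiM_cong[OF refl]) (rule iid(2)[OF \<phi>])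
  finally have D: "distr M (\<Pi>\<^sub>M i\<in>{1..?m}. P) (\<lambda>\<omega>. \<lambda>i\<in>{1..?m}. X (?\<phi> i) \<omega>) = (\<Pi>\<^sub>M i\<in>{1..?m}. P)" .
  have 1: "(\<lambda>\<omega>. \<lambda>i\<in>{1..?m}. X (?\<phi> i) \<omega>) \<in> measurable M (\<Pi>\<^sub>M i\<in>{1..?m}. P)"
    by (intro measurable_restrict rv \<phi>)
  have 2: "(\<lambda>x. \<A> (map x [1..<Suc ?m])) \<in> borel_measurable (\<Pi>\<^sub>M i\<in>{1..?m}. P)"
    using est by (simp add: estimation_procedure_def)
  have eq: "map (\<lambda>i\<in>{1..?m}. X (?\<phi> i) \<omega>) [1..<Suc ?m] = map (\<lambda>i. X i \<omega>) l" for \<omega>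
    by (rule nth_equalityI) (auto simp del: upt_Suc)
  have "sample_law P \<A> ?m = distr M borel (\<lambda>\<omega>. \<A> (map (\<lambda>i. X i \<omega>) l))"
    unfolding sample_law_def by (subst D[symmetric], subst distr_distr[OF 2 1]) (simp only: comp_def eq)
  then show ?thesis ..
qed

lemma not_in_rectangular_hull_iff:
  assumes "b \<ge> 1"
  shows "\<theta> \<notin> rectangular_hull b t \<longleftrightarrow>
    (\<exists>j. (\<forall>k\<in>{1..b}. \<theta> $ j < t k $ j) \<or> (\<forall>k\<in>{1..b}. t k $ j < \<theta> $ j))"
proof -
  have ne: "finite ((\<lambda>k. t k $ j) ` {1..b})" "(\<lambda>k. t k $ j) ` {1..b} \<noteq> {}" for j using assms by auto
  have "\<theta> \<in> rectangular_hull b t \<longleftrightarrow>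
      (\<forall>j. (MIN k\<in>{1..b}. t k $ j) \<le> \<theta> $ j \<and> \<theta> $ j \<le> (MAX k\<in>{1..b}. t k $ j))"
    by (simp add: rectangular_hull_def mem_box_cart)
  also have "\<dots> \<longleftrightarrow> (\<forall>j. (\<exists>k\<in>{1..b}. t k $ j \<le> \<theta> $ j) \<and> (\<exists>k\<in>{1..b}. \<theta> $ j \<le> t k $ j))"
    unfolding Min_le_iff[OF ne] Max_ge_iff[OF ne] by simp
  finally show ?thesis by (auto simp: not_le not_less)
qed

section \<open>Sign vectors and orthants\<close>

lemma batch_splitsD:
  assumes "\<sigma> \<in> batch_splits n b" "k \<in> {1..b}"
  shows "\<sigma> k \<subseteq> {1..n}" "finite (\<sigma> k)" "card (\<sigma> k) = n div b"
proof -
  show 1: "\<sigma> k \<subseteq> {1..n}" using assms unfolding batch_splits_def by blast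
  show "finite (\<sigma> k)" using finite_subset[OF 1] by simp
  show "card (\<sigma> k) = n div b" using assms unfolding batch_splits_def by blast
qed

lemma finite_batch_splits: "finite (batch_splits n b)"
  unfolding batch_splits_def by (intro finite_subset[OF Collect_subset] finite_PiE) auto

lemma measurable_vec_component: "(\<lambda>w :: real ^ 'd::finite. w $ j) \<in> borel_measurable borel"
  by (intro borel_measurable_continuous_onI continuous_intros)

lemma sets_strict_orthant: "{w :: real ^ 'd::finite. \<forall>j. (\<theta> $ j < w $ j) = x j} \<in> sets borel"
proof -
  have "{w :: real ^ 'd. (\<theta> $ j < w $ j) = x j} \<in> sets borel" for j
    using measurable_vec_component[measurable, of j] by measurable
  then have "(\<Inter>j\<in>UNIV. {w :: real ^ 'd. (\<theta> $ j < w $ j) = x j}) \<in> sets borel"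
    by (intro sets.finite_INT) auto
  also have "(\<Inter>j\<in>UNIV. {w :: real ^ 'd. (\<theta> $ j < w $ j) = x j}) =
      {w. \<forall>j. (\<theta> $ j < w $ j) = x j}" by auto
  finally show ?thesis .
qed

lemma sets_coordinate_hyperplanes: "{w :: real ^ 'd::finite. \<exists>j. w $ j = \<theta> $ j} \<in> sets borel"
proof -
  have "{w :: real ^ 'd. w $ j = \<theta> $ j} \<in> sets borel" for j
    using measurable_vec_component[measurable, of j] by measurable
  then have "(\<Union>j\<in>UNIV. {w :: real ^ 'd. w $ j = \<theta> $ j}) \<in> sets borel"
    by (intro sets.finite_UN) auto
  also have "(\<Union>j\<in>UNIV. {w :: real ^ 'd. w $ j = \<theta> $ j}) = {w. \<exists>j. w $ j = \<theta> $ j}" by auto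
  finally show ?thesis .
qed

lemma sets_closed_orthant_translate:
  assumes "A \<in> closed_orthants"
  shows "{w :: real ^ 'd::finite. w - \<theta> \<in> A} \<in> sets borel"
proof -
  from assms obtain \<eta> where A: "A = {x. \<forall>j. \<eta> j * x $ j \<ge> 0}" by (auto simp: closed_orthants_def)
  have "{w :: real ^ 'd. \<eta> j * (w $ j - \<theta> $ j) \<ge> 0} \<in> sets borel" for j
    using measurable_vec_component[measurable, of j] by measurable
  then have "(\<Inter>j\<in>UNIV. {w :: real ^ 'd. \<eta> j * (w $ j - \<theta> $ j) \<ge> 0}) \<in> sets borel"
    by (intro sets.finite_INT) auto
  also have "(\<Inter>j\<in>UNIV. {w :: real ^ 'd. \<eta> j * (w $ j - \<theta> $ j) \<ge> 0}) = {w. w - \<theta> \<in> A}"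
    by (auto simp: A)
  finally show ?thesis .
qed

lemma const_coord_map: "const_coord (map f l) \<longleftrightarrow> (\<exists>j s. \<forall>k\<in>set l. f k j = s)"
  unfolding const_coord_def set_map Set.ball_simps(9) ..

text \<open>The bit True stands for an estimator strictly above \<theta> in that coordinate; only in
  the absence of ties does False mean strictly below, as missing the closed box requires.\<close>

lemma not_in_hull_iff_const_coord:
  assumes "b \<ge> 1" and ne: "\<And>k j. k \<in> {1..b} \<Longrightarrow> t k $ j \<noteq> \<theta> $ j"
  shows "\<theta> \<notin> rectangular_hull b t \<longleftrightarrow> const_coord (map (\<lambda>k j. \<theta> $ j < t k $ j) [1..<Suc b])"
proof -
  have s: "set [1..<Suc b] = {1..b}" by auto
  have "const_coord (map (\<lambda>k j. \<theta> $ j < t k $ j) [1..<Suc b]) \<longleftrightarrow>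
      (\<exists>j s. \<forall>k\<in>{1..b}. (\<theta> $ j < t k $ j) = s)"
    unfolding const_coord_map s ..
  also have "\<dots> \<longleftrightarrow> (\<exists>j. (\<forall>k\<in>{1..b}. \<theta> $ j < t k $ j) \<or> (\<forall>k\<in>{1..b}. \<not> \<theta> $ j < t k $ j))"
    by (simp only: ex_bool_eq simp_thms)
  also have "\<dots> \<longleftrightarrow> (\<exists>j. (\<forall>k\<in>{1..b}. \<theta> $ j < t k $ j) \<or> (\<forall>k\<in>{1..b}. t k $ j < \<theta> $ j))"
    using ne by (intro ex_cong1 disj_cong refl ball_cong) (metis less_le_not_le linorder_neqE)
  finally show ?thesis unfolding not_in_rectangular_hull_iff[OF assms(1)] ..
qed

lemma finite_closed_orthants: "finite (closed_orthants :: (real ^ 'd::finite) set set)"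
proof -
  have "closed_orthants \<subseteq> (\<lambda>\<eta>. {x :: real ^ 'd. \<forall>j. \<eta> j * x $ j \<ge> 0}) ` (UNIV \<rightarrow>\<^sub>E {- 1, 1})"
    by (auto simp: closed_orthants_def PiE_def)
  then show ?thesis by (rule finite_subset) (intro finite_imageI finite_PiE, auto)
qed

lemma closed_orthant_prob_ge:
  assumes "O_Med_bias M \<theta> \<theta>\<^sub>0 \<le> \<delta>" and A: "A \<in> (closed_orthants :: (real ^ 'd::finite) set set)"
  shows "measure M {\<omega> \<in> space M. \<theta> \<omega> - \<theta>\<^sub>0 \<in> A} \<ge> 1 / 2 ^ CARD('d) - \<delta> / 2 ^ (CARD('d) - 1)"
proof -
  let ?f = "\<lambda>A. measure M {\<omega> \<in> space M. \<theta> \<omega> - \<theta>\<^sub>0 \<in> A}"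
  let ?m = "Min (?f ` (closed_orthants :: (real ^ 'd) set set))"
  have "2 ^ (CARD('d) - 1) * (1 / 2 ^ CARD('d) - ?m)
      \<le> 2 ^ (CARD('d) - 1) * max 0 (1 / 2 ^ CARD('d) - ?m)"
    by (intro mult_left_mono) auto
  also have "\<dots> \<le> \<delta>" using assms(1) by (simp add: O_Med_bias_def)
  finally have "1 / 2 ^ CARD('d) - ?m \<le> \<delta> / 2 ^ (CARD('d) - 1)" by (simp add: field_simps)
  moreover have "?m \<le> ?f A" using A by (intro Min_le finite_imageI finite_closed_orthants imageI)
  ultimately show ?thesis by linarith
qed

text \<open>The bias bounds closed orthants, whereas the events
  \<open>(\<theta> $ j < w $ j) = x0 j\<close> form a partition. The two differ only on the
  coordinate hyperplanes through \<theta>, which are null under MCH.\<close>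

lemma strict_orthant_subset:
  "{w :: real ^ 'd::finite. w - \<theta> \<in> {x. \<forall>j. (if x0 j then 1 else - 1) * x $ j \<ge> 0}}
    \<subseteq> {w. \<forall>j. (\<theta> $ j < w $ j) = x0 j} \<union> {w. \<exists>j. w $ j = \<theta> $ j}"
proof
  fix w assume "w \<in> {w :: real ^ 'd. w - \<theta> \<in> {x. \<forall>j. (if x0 j then 1 else - 1) * x $ j \<ge> 0}}"
  then have w: "(if x0 j then 1 else - 1) * (w $ j - \<theta> $ j) \<ge> 0" for j by simp
  show "w \<in> {w. \<forall>j. (\<theta> $ j < w $ j) = x0 j} \<union> {w. \<exists>j. w $ j = \<theta> $ j}"
  proof (cases "\<exists>j. w $ j = \<theta> $ j")
    case False
    have "(\<theta> $ j < w $ j) = x0 j" for j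
      using w[of j] False by (cases "x0 j") (auto simp: order.order_iff_strict)
    then show ?thesis by blast
  qed blast
qed

section \<open>Miss probability for a given number of batches\<close>

locale iid_estimation = prob_space M for M :: "'w measure" +
  fixes P :: "'x measure" and X :: "nat \<Rightarrow> 'w \<Rightarrow> 'x" and n :: nat
    and \<A> :: "'x list \<Rightarrow> real ^ 'd::finite"
  assumes indep_X: "indep_vars (\<lambda>_. P) X {1..n}"
    and distr_X: "\<And>i. i \<in> {1..n} \<Longrightarrow> distr M P (X i) = P"
    and est: "estimation_procedure P \<A>" and prob_P: "prob_space P"
begin

lemma measurable_fixed_batch:
  assumes "\<sigma> \<in> batch_splits n b" "k \<in> {1..b}"
  shows "(\<lambda>x. \<A> (map x (sorted_list_of_set (\<sigma> k)))) \<in> borel_measurable (\<Pi>\<^sub>M i\<in>{1..n}. P)"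
  using batch_splitsD[OF assms] by (intro estimation_procedure_measurable est) auto

lemma distr_fixed_batch:
  assumes "\<sigma> \<in> batch_splits n b" "k \<in> {1..b}" "1 \<le> b" "b \<le> n"
  shows "distr M borel (batch_estimator \<A> X (\<lambda>_. \<sigma>) k) = sample_law P \<A> (n div b)"
proof -
  note s = batch_splitsD[OF assms(1,2)]
  \<comment> \<open>\<open>b \<le> n\<close> makes the batches nonempty, as
    \<open>distr_subsample_estimator\<close> requires.\<close>
  have "n div b \<noteq> 0" using assms(3,4) by (simp add: div_eq_0_iff)
  then have "sorted_list_of_set (\<sigma> k) \<noteq> []" using s by auto
  then have "distr M borel (\<lambda>\<omega>. \<A> (map (\<lambda>i. X i \<omega>) (sorted_list_of_set (\<sigma> k))))
      = sample_law P \<A> (length (sorted_list_of_set (\<sigma> k)))"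
    using s by (intro distr_subsample_estimator[OF prob_space_axioms indep_X distr_X est]) auto
  then show ?thesis using s by (simp add: batch_estimator_def[abs_def])
qed

lemma indep_fixed_batches:
  assumes \<sigma>: "\<sigma> \<in> batch_splits n b"
  shows "indep_vars (\<lambda>_. borel) (batch_estimator \<A> X (\<lambda>_. \<sigma>)) {1..b}"
proof -
  have "disjoint_family_on \<sigma> {1..b}" using \<sigma> by (auto simp: batch_splits_def)
  then have "indep_vars (\<lambda>k. PiM (\<sigma> k) (\<lambda>_. P)) (\<lambda>k \<omega>. restrict (\<lambda>i. X i \<omega>) (\<sigma> k)) {1..b}"
    using batch_splitsD(1)[OF \<sigma>] by (intro indep_vars_restrict[OF indep_X])
  then have "indep_vars (\<lambda>_. borel)
      (\<lambda>k \<omega>. \<A> (map (restrict (\<lambda>i. X i \<omega>) (\<sigma> k)) (sorted_list_of_set (\<sigma> k)))) {1..b}"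
    by (rule indep_vars_compose2)
       (use batch_splitsD[OF \<sigma>] in \<open>auto intro!: estimation_procedure_measurable est\<close>)
  also have "?this \<longleftrightarrow> ?thesis"
  proof (rule indep_vars_cong[OF refl _ refl])
    fix k assume "k \<in> {1..b}"
    note s = batch_splitsD[OF \<sigma> this]
    \<comment> \<open>The estimator reads the sample only at indices in its batch, where the
      restriction is invisible.\<close>
    have "map (restrict (\<lambda>i. X i \<omega>) (\<sigma> k)) (sorted_list_of_set (\<sigma> k)) =
        map (\<lambda>i. X i \<omega>) (sorted_list_of_set (\<sigma> k))" for \<omega>
      using s by (intro map_cong refl) auto
    then show "(\<lambda>\<omega>. \<A> (map (restrict (\<lambda>i. X i \<omega>) (\<sigma> k)) (sorted_list_of_set (\<sigma> k)))) =
        batch_estimator \<A> X (\<lambda>_. \<sigma>) k"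
      unfolding batch_estimator_def by presburger
  qed
  finally show ?thesis .
qed

text \<open>Once the split is fixed to \<sigma>, the batches are deterministic and the probability
  \<open>c\<close> is the same for all \<sigma>. Only joint independence of (V, S) from the data
  enters, so V and the split may depend on each other. \<open>Q\<close> must look at batches 1, ...,
  b alone: a split has no meaningful value elsewhere.\<close>

lemma prob_batch_mixture:
  assumes ind: "indep_rv M (\<Pi>\<^sub>M i\<in>{1..n}. P) (\<lambda>\<omega>. \<lambda>i\<in>{1..n}. X i \<omega>)
      (borel \<Otimes>\<^sub>M count_space (batch_splits n b)) (\<lambda>\<omega>. (V \<omega>, S \<omega>))"
    and D: "D \<in> sets borel"
    and Q: "\<And>t t'. (\<And>k. k \<in> {1..b} \<Longrightarrow> t k = t' k) \<Longrightarrow> Q t = Q t'"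
    and meas: "\<And>\<sigma>. \<sigma> \<in> batch_splits n b \<Longrightarrow>
      {x \<in> space (\<Pi>\<^sub>M i\<in>{1..n}. P). Q (\<lambda>k. \<A> (map x (sorted_list_of_set (\<sigma> k))))} \<in> sets (\<Pi>\<^sub>M i\<in>{1..n}. P)"
    and c: "\<And>\<sigma>. \<sigma> \<in> batch_splits n b \<Longrightarrow>
      prob {\<omega> \<in> space M. Q (\<lambda>k. batch_estimator \<A> X (\<lambda>_. \<sigma>) k \<omega>)} = c"
  shows "{\<omega> \<in> space M. V \<omega> \<in> D \<and> Q (\<lambda>k. batch_estimator \<A> X S k \<omega>)} \<in> events"
    and "prob {\<omega> \<in> space M. V \<omega> \<in> D \<and> Q (\<lambda>k. batch_estimator \<A> X S k \<omega>)}
    = c * prob {\<omega> \<in> space M. V \<omega> \<in> D}"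
proof -
  let ?N = "\<Pi>\<^sub>M i\<in>{1..n}. P" and ?I = "batch_splits n b" and ?f = "\<lambda>\<omega>. \<lambda>i\<in>{1..n}. X i \<omega>"
  let ?A = "\<lambda>\<sigma>. {x \<in> space ?N. Q (\<lambda>k. \<A> (map x (sorted_list_of_set (\<sigma> k))))}"
  have f: "?f \<in> measurable M ?N" and "(\<lambda>\<omega>. (V \<omega>, S \<omega>)) \<in> measurable M (borel \<Otimes>\<^sub>M count_space ?I)"
    using ind unfolding indep_rv_def by blast+
  from measurable_space[OF this(2)] have S: "S \<omega> \<in> ?I" if "\<omega> \<in> space M" for \<omega>
    using that by (simp add: space_pair_measure)
  have fA: "?f \<omega> \<in> ?A \<sigma> \<longleftrightarrow> Q (\<lambda>k. batch_estimator \<A> X (\<lambda>_. \<sigma>) k \<omega>)"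
    if "\<omega> \<in> space M" "\<sigma> \<in> ?I" for \<omega> \<sigma>
  proof -
    have "Q (\<lambda>k. \<A> (map (?f \<omega>) (sorted_list_of_set (\<sigma> k)))) = Q (\<lambda>k. batch_estimator \<A> X (\<lambda>_. \<sigma>) k \<omega>)"
    proof (rule Q)
      fix k assume "k \<in> {1..b}"
      note s = batch_splitsD[OF that(2) this]
      have "map (?f \<omega>) (sorted_list_of_set (\<sigma> k)) = map (\<lambda>i. X i \<omega>) (sorted_list_of_set (\<sigma> k))"
        using s by (intro map_cong refl) auto
      then show "\<A> (map (?f \<omega>) (sorted_list_of_set (\<sigma> k))) = batch_estimator \<A> X (\<lambda>_. \<sigma>) k \<omega>"
        by (simp only: batch_estimator_def)
    qed
    then show ?thesis using measurable_space[OF f that(1)] by simp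
  qed
  have G: "D \<times> {\<sigma>} \<in> sets (borel \<Otimes>\<^sub>M count_space ?I)" if "\<sigma> \<in> ?I" for \<sigma>
    using D that by (intro pair_measureI) auto
  have dis: "disjoint_family_on (\<lambda>\<sigma>. D \<times> {\<sigma>}) ?I" by (auto simp: disjoint_family_on_def)
  have cA: "prob {\<omega> \<in> space M. ?f \<omega> \<in> ?A \<sigma>} = c" if "\<sigma> \<in> ?I" for \<sigma>
    using c[OF that] fA[OF _ that] by (metis (mono_tags, lifting) Collect_cong)
  note mixture = prob_indep_mixture[where G = "\<lambda>\<sigma>. D \<times> {\<sigma>}" and A = ?A,
      OF prob_space_axioms ind finite_batch_splits G dis meas cA]
  have 1: "{\<omega> \<in> space M. \<exists>\<sigma>\<in>?I. (V \<omega>, S \<omega>) \<in> D \<times> {\<sigma>}} = {\<omega> \<in> space M. V \<omega> \<in> D}"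
    using S by auto
  have 2: "{\<omega> \<in> space M. \<exists>\<sigma>\<in>?I. (V \<omega>, S \<omega>) \<in> D \<times> {\<sigma>} \<and> ?f \<omega> \<in> ?A \<sigma>} =
      {\<omega> \<in> space M. V \<omega> \<in> D \<and> Q (\<lambda>k. batch_estimator \<A> X S k \<omega>)}"
  proof (intro Collect_cong conj_cong refl)
    fix \<omega> assume \<omega>: "\<omega> \<in> space M"
    have "(\<exists>\<sigma>\<in>?I. (V \<omega>, S \<omega>) \<in> D \<times> {\<sigma>} \<and> ?f \<omega> \<in> ?A \<sigma>) \<longleftrightarrow> V \<omega> \<in> D \<and> ?f \<omega> \<in> ?A (S \<omega>)"
      using S[OF \<omega>] by blast
    also have "\<dots> \<longleftrightarrow> V \<omega> \<in> D \<and> Q (\<lambda>k. batch_estimator \<A> X S k \<omega>)"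
      unfolding fA[OF \<omega> S[OF \<omega>]] by (simp add: batch_estimator_def)
    finally show "(\<exists>\<sigma>\<in>?I. (V \<omega>, S \<omega>) \<in> D \<times> {\<sigma>} \<and> ?f \<omega> \<in> ?A \<sigma>) \<longleftrightarrow>
      V \<omega> \<in> D \<and> Q (\<lambda>k. batch_estimator \<A> X S k \<omega>)" .
  qed
  show "{\<omega> \<in> space M. V \<omega> \<in> D \<and> Q (\<lambda>k. batch_estimator \<A> X S k \<omega>)} \<in> events"
    by (rule mixture(1)[unfolded 2])
  show "prob {\<omega> \<in> space M. V \<omega> \<in> D \<and> Q (\<lambda>k. batch_estimator \<A> X S k \<omega>)}
      = c * prob {\<omega> \<in> space M. V \<omega> \<in> D}"
    by (rule mixture(2)[unfolded 1 2])
qed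

lemma prob_fixed_split_miss:
  assumes \<sigma>: "\<sigma> \<in> batch_splits n b" and b: "1 \<le> b" "b \<le> n"
    and null: "measure (sample_law P \<A> (n div b)) {w. \<exists>j. w $ j = \<theta> $ j} = 0"
  shows "prob {\<omega> \<in> space M. \<theta> \<notin> rectangular_hull b (\<lambda>k. batch_estimator \<A> X (\<lambda>_. \<sigma>) k \<omega>)} =
    list_exp (\<lambda>x. measure (sample_law P \<A> (n div b)) {w. \<forall>j. (\<theta> $ j < w $ j) = x j}) b
      (\<lambda>l. of_bool (const_coord l))"
    (is "prob ?miss = list_exp ?p b _")
proof -
  let ?Y = "batch_estimator \<A> X (\<lambda>_. \<sigma>)" and ?\<mu> = "sample_law P \<A> (n div b)"
  let ?sgn = "\<lambda>(w :: real ^ 'd) j. \<theta> $ j < w $ j"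
  have Y: "?Y k \<in> borel_measurable M" if "k \<in> {1..b}" for k
    using indep_fixed_batches[OF \<sigma>] that by (auto simp: indep_vars_def)
  have \<mu>: "prob {\<omega> \<in> space M. ?Y k \<omega> \<in> C} = measure ?\<mu> C" if "k \<in> {1..b}" "C \<in> sets borel" for k C
    unfolding distr_fixed_batch[OF \<sigma> that(1) b, symmetric]
    by (subst measure_distr[OF Y[OF that(1)] that(2)]) (simp add: vimage_def Int_def conj_commute)
  have sgn: "?sgn \<in> measurable borel (count_space UNIV)"
  proof (subst measurable_count_space_eq2)
    have "?sgn -` {x} \<inter> space borel \<in> sets borel" for x
      using sets_strict_orthant[of \<theta> x] by (simp add: vimage_def fun_eq_iff)
    then show "?sgn \<in> space borel \<rightarrow> UNIV \<and> (\<forall>a\<in>UNIV. ?sgn -` {a} \<inter> space borel \<in> sets borel)" by blast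
  qed simp
  have indZ: "indep_vars (\<lambda>_. count_space UNIV) (\<lambda>k \<omega>. ?sgn (?Y k \<omega>)) {1..b}"
    by (rule indep_vars_compose2[OF indep_fixed_batches[OF \<sigma>] sgn])
  have pZ: "prob {\<omega> \<in> space M. ?sgn (?Y k \<omega>) = x} = ?p x" if "k \<in> {1..b}" for k x
    using \<mu>[OF that sets_strict_orthant[of \<theta> x]] by (simp add: fun_eq_iff)
  let ?const = "{\<omega> \<in> space M. const_coord (map (\<lambda>k. ?sgn (?Y k \<omega>)) [1..<Suc b])}"
  have const: "prob ?const = list_exp ?p b (\<lambda>l. of_bool (const_coord l))"
    by (rule prob_indep_list(2)[OF indZ b(1) pZ])
  have "AE \<omega> in M. \<not> (\<exists>j. ?Y k \<omega> $ j = \<theta> $ j)" if k: "k \<in> {1..b}" for k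
  proof (rule AE_I')
    let ?N = "{\<omega> \<in> space M. ?Y k \<omega> \<in> {w. \<exists>j. w $ j = \<theta> $ j}}"
    have "?N \<in> events"
      using measurable_sets[OF Y[OF k] sets_coordinate_hyperplanes[of \<theta>]]
      by (simp add: vimage_def Int_def conj_commute)
    moreover have "prob ?N = 0" using \<mu>[OF k sets_coordinate_hyperplanes[of \<theta>]] null by simp
    ultimately show "?N \<in> null_sets M" by (simp add: null_sets_def emeasure_eq_measure)
    show "{\<omega> \<in> space M. \<not> \<not> (\<exists>j. ?Y k \<omega> $ j = \<theta> $ j)} \<subseteq> ?N" by auto
  qed
  \<comment> \<open>Finitely many batches, so almost surely no estimator ties with \<theta> in any
    coordinate; there the miss event is the sign event.\<close>
  then have ne: "AE \<omega> in M. \<forall>k\<in>{1..b}. \<not> (\<exists>j. ?Y k \<omega> $ j = \<theta> $ j)" by (intro AE_finite_allI) auto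
  have "prob ?miss = prob ?const"
  proof (rule finite_measure_eq_AE)
    show "AE \<omega> in M. \<omega> \<in> ?miss \<longleftrightarrow> \<omega> \<in> ?const"
      using ne
    proof eventually_elim
      case (elim \<omega>)
      then show ?case using not_in_hull_iff_const_coord[OF b(1), of "\<lambda>k. ?Y k \<omega>" \<theta>] by blast
    qed
    have lt: "{\<omega> \<in> space M. \<theta> $ j < ?Y k \<omega> $ j} \<in> events" "{\<omega> \<in> space M. ?Y k \<omega> $ j < \<theta> $ j} \<in> events"
      if "k \<in> {1..b}" for k j
      using measurable_compose[OF Y[OF that] measurable_vec_component[of j]]
      by (auto intro: borel_measurable_less borel_measurable_const)
    have "{\<omega> \<in> space M. \<exists>j\<in>UNIV. (\<forall>k\<in>{1..b}. \<theta> $ j < ?Y k \<omega> $ j) \<or> (\<forall>k\<in>{1..b}. ?Y k \<omega> $ j < \<theta> $ j)} \<in> events"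
      by (intro sets.sets_Collect_finite_Ex sets.sets_Collect_disj sets.sets_Collect_finite_All lt finite finite_atLeastAtMost)
    then show "?miss \<in> events"
      unfolding not_in_rectangular_hull_iff[OF b(1)] by simp
    show "?const \<in> events" by (rule prob_indep_list(1)[OF indZ b(1) pZ])
  qed
  then show ?thesis unfolding const .
qed

lemma prob_space_sample_law: "prob_space (sample_law P \<A> m)"
proof -
  interpret PiP: prob_space "\<Pi>\<^sub>M i\<in>{1..m}. P" by (intro prob_space_PiM prob_P)
  show ?thesis
    unfolding sample_law_def
    using est by (intro PiP.prob_space_distr) (simp add: estimation_procedure_def)
qed

lemma sets_sample_law [simp]: "sets (sample_law P \<A> m) = sets borel"
  by (simp add: sample_law_def)

text \<open>Carries the MCH and bias hypotheses, which concern batches of a random split, over to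
  \<open>sample_law\<close>.\<close>

lemma prob_random_batch:
  assumes ind: "indep_rv M (\<Pi>\<^sub>M i\<in>{1..n}. P) (\<lambda>\<omega>. \<lambda>i\<in>{1..n}. X i \<omega>)
      (borel \<Otimes>\<^sub>M count_space (batch_splits n b)) (\<lambda>\<omega>. (V \<omega>, S \<omega>))"
    and b: "1 \<le> b" "b \<le> n" and k: "k \<in> {1..b}" and C: "C \<in> sets borel"
  shows "prob {\<omega> \<in> space M. batch_estimator \<A> X S k \<omega> \<in> C} = measure (sample_law P \<A> (n div b)) C"
proof -
  have "prob {\<omega> \<in> space M. V \<omega> \<in> UNIV \<and> batch_estimator \<A> X S k \<omega> \<in> C} =
      measure (sample_law P \<A> (n div b)) C * prob {\<omega> \<in> space M. V \<omega> \<in> UNIV}"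
  proof (rule prob_batch_mixture(2)[OF ind, where Q = "\<lambda>t. t k \<in> C"])
    fix \<sigma> assume \<sigma>: "\<sigma> \<in> batch_splits n b"
    show "{x \<in> space (\<Pi>\<^sub>M i\<in>{1..n}. P). \<A> (map x (sorted_list_of_set (\<sigma> k))) \<in> C} \<in> sets (\<Pi>\<^sub>M i\<in>{1..n}. P)"
      using measurable_sets[OF measurable_fixed_batch[OF \<sigma> k] C]
      by (simp only: vimage_def Int_def mem_Collect_eq conj_commute)
    have "batch_estimator \<A> X (\<lambda>_. \<sigma>) k \<in> borel_measurable M"
      using indep_fixed_batches[OF \<sigma>] k by (auto simp: indep_vars_def)
    then show "prob {\<omega> \<in> space M. batch_estimator \<A> X (\<lambda>_. \<sigma>) k \<omega> \<in> C} =
        measure (sample_law P \<A> (n div b)) C"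
      unfolding distr_fixed_batch[OF \<sigma> k b, symmetric]
      by (subst measure_distr[OF _ C]) (simp_all add: vimage_def Int_def conj_commute)
  qed (use k in auto)
  then show ?thesis by (simp add: prob_space)
qed

text \<open>The number \<open>c\<close> is the conditional miss probability given V, constant in V.
  Quantifying over \<open>D\<close> after \<open>c\<close> allows the same \<open>c\<close> to be
  used on the part of the range of V where \<open>b\<close> batches are chosen. Batch 1 reveals the
  common law of all batches.\<close>

lemma hull_miss_approx:
  assumes ind: "indep_rv M (\<Pi>\<^sub>M i\<in>{1..n}. P) (\<lambda>\<omega>. \<lambda>i\<in>{1..n}. X i \<omega>)
      (borel \<Otimes>\<^sub>M count_space (batch_splits n b)) (\<lambda>\<omega>. (V \<omega>, S \<omega>))"
    and b: "1 \<le> b" "b \<le> n" and \<delta>: "\<delta> \<ge> 0"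
    and mch: "MCH M (\<lambda>\<omega>. batch_estimator \<A> X S 1 \<omega> - \<theta>)"
    and bias: "O_Med_bias M (batch_estimator \<A> X S 1) \<theta> \<le> \<delta>"
  shows "\<exists>c. \<bar>c - hull_U b CARD('d)\<bar> \<le> 2 ^ (CARD('d) - 1) * (real b * (real b - 1)) * \<delta>\<^sup>2 \<and>
    (\<forall>D\<in>sets borel.
      {\<omega> \<in> space M. V \<omega> \<in> D \<and> \<theta> \<notin> rectangular_hull b (\<lambda>k. batch_estimator \<A> X S k \<omega>)} \<in> events \<and>
      prob {\<omega> \<in> space M. V \<omega> \<in> D \<and> \<theta> \<notin> rectangular_hull b (\<lambda>k. batch_estimator \<A> X S k \<omega>)}
        = c * prob {\<omega> \<in> space M. V \<omega> \<in> D})"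
proof -
  let ?\<mu> = "sample_law P \<A> (n div b)"
  interpret \<mu>: prob_space ?\<mu> by (rule prob_space_sample_law)
  let ?O = "\<lambda>x. {w :: real ^ 'd. \<forall>j. (\<theta> $ j < w $ j) = x j}" and ?Z = "{w :: real ^ 'd. \<exists>j. w $ j = \<theta> $ j}"
  define p where "p x = measure ?\<mu> (?O x)" for x
  have law: "prob {\<omega> \<in> space M. batch_estimator \<A> X S 1 \<omega> \<in> C} = measure ?\<mu> C" if "C \<in> sets borel" for C
    using b that by (intro prob_random_batch[OF ind]) auto
  have null: "measure ?\<mu> ?Z = 0"
    using mch law[OF sets_coordinate_hyperplanes[of \<theta>]] by (simp add: MCH_def)
  have "disjoint_family_on ?O UNIV"
    unfolding disjoint_family_on_def
  proof (intro ballI impI equals0I)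
    fix x y w assume "x \<noteq> y" and w: "w \<in> ?O x \<inter> ?O y"
    have "x j = y j" for j
    proof -
      have "(\<theta> $ j < w $ j) = x j" "(\<theta> $ j < w $ j) = y j" using w by blast+
      then show ?thesis by argo
    qed
    with \<open>x \<noteq> y\<close> show False by blast
  qed
  then have "sum p UNIV = measure ?\<mu> (\<Union>x\<in>UNIV. ?O x)"
    unfolding p_def
    by (intro \<mu>.finite_measure_finite_Union[symmetric] finite)
      (simp_all only: image_subset_iff sets_sample_law sets_strict_orthant simp_thms ball_UNIV)
  also have "(\<Union>x\<in>UNIV. ?O x) = space ?\<mu>"
  proof -
    have "w \<in> (\<Union>x\<in>UNIV. ?O x)" for w
      by (rule UN_I[where a = "\<lambda>j. \<theta> $ j < w $ j", OF UNIV_I]) simp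
    then have "(\<Union>x\<in>UNIV. ?O x) = UNIV" by (rule UNIV_eq_I[symmetric])
    then show ?thesis by (simp only: sample_law_def space_distr space_borel)
  qed
  finally have sum1: "sum p UNIV = 1" by (simp add: \<mu>.prob_space)
  have low: "p x \<ge> 1 / 2 ^ CARD('d) - \<delta> / 2 ^ (CARD('d) - 1)" for x
  proof -
    let ?A = "{y :: real ^ 'd. \<forall>j. (if x j then 1 else - 1) * y $ j \<ge> 0}"
    have A: "?A \<in> closed_orthants"
      unfolding closed_orthants_def
      by (intro CollectI exI[of _ "\<lambda>j. if x j then 1 else - 1"] conjI refl) simp
    \<comment> \<open>The bound holds for the closed orthant and passes to the sign class at the
      cost of the null set \<open>?Z\<close>.\<close>
    have "1 / 2 ^ CARD('d) - \<delta> / 2 ^ (CARD('d) - 1) \<le> measure ?\<mu> {w. w - \<theta> \<in> ?A}"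
      using closed_orthant_prob_ge[OF bias A] law[OF sets_closed_orthant_translate[OF A, of \<theta>]] by simp
    also have "\<dots> \<le> measure ?\<mu> (?O x \<union> ?Z)"
      by (rule \<mu>.finite_measure_mono[OF strict_orthant_subset])
        (simp add: sets.Un sets_strict_orthant sets_coordinate_hyperplanes)
    also have "\<dots> \<le> p x + measure ?\<mu> ?Z"
      unfolding p_def by (rule measure_Un_le) (simp_all add: sets_strict_orthant sets_coordinate_hyperplanes)
    finally show ?thesis using null by simp
  qed
  have "p x \<ge> 0" for x by (simp add: p_def)
  then have approx: "\<bar>list_exp p b (\<lambda>l. of_bool (const_coord l)) - hull_U b CARD('d)\<bar>
      \<le> 2 ^ (CARD('d) - 1) * (real b * (real b - 1)) * \<delta>\<^sup>2"
    by (rule list_exp_const_coord_approx[OF _ sum1 low \<delta> b(1)])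
  have hull: "(\<theta> \<notin> rectangular_hull b t) = (\<theta> \<notin> rectangular_hull b t')"
    if "\<And>k. k \<in> {1..b} \<Longrightarrow> t k = t' k" for t t' :: "nat \<Rightarrow> real ^ 'd"
    unfolding not_in_rectangular_hull_iff[OF b(1)] using that by simp
  have meas: "{x \<in> space (\<Pi>\<^sub>M i\<in>{1..n}. P). \<theta> \<notin> rectangular_hull b (\<lambda>k. \<A> (map x (sorted_list_of_set (\<sigma> k))))}
      \<in> sets (\<Pi>\<^sub>M i\<in>{1..n}. P)" if \<sigma>: "\<sigma> \<in> batch_splits n b" for \<sigma>
  proof -
    let ?N = "\<Pi>\<^sub>M i\<in>{1..n}. P" and ?t = "\<lambda>x k. \<A> (map x (sorted_list_of_set (\<sigma> k)))"
    have lt: "{x \<in> space ?N. \<theta> $ j < ?t x k $ j} \<in> sets ?N" "{x \<in> space ?N. ?t x k $ j < \<theta> $ j} \<in> sets ?N"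
      if "k \<in> {1..b}" for k j
      using measurable_compose[OF measurable_fixed_batch[OF \<sigma> that] measurable_vec_component[of j]]
      by (intro borel_measurable_less borel_measurable_const, assumption)+
    have "{x \<in> space ?N. \<exists>j\<in>UNIV. (\<forall>k\<in>{1..b}. \<theta> $ j < ?t x k $ j) \<or> (\<forall>k\<in>{1..b}. ?t x k $ j < \<theta> $ j)} \<in> sets ?N"
      by (intro sets.sets_Collect_finite_Ex sets.sets_Collect_disj sets.sets_Collect_finite_All lt finite finite_atLeastAtMost)
    then show ?thesis
      unfolding not_in_rectangular_hull_iff[OF b(1)] by simp
  qed
  have miss: "prob {\<omega> \<in> space M. \<theta> \<notin> rectangular_hull b (\<lambda>k. batch_estimator \<A> X (\<lambda>_. \<sigma>) k \<omega>)} =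
      list_exp p b (\<lambda>l. of_bool (const_coord l))" if \<sigma>: "\<sigma> \<in> batch_splits n b" for \<sigma>
    unfolding p_def by (rule prob_fixed_split_miss[OF \<sigma> b null])
  note mixture = prob_batch_mixture[OF ind _ hull meas miss]
  show ?thesis
    by (intro exI conjI ballI, rule approx, rule mixture(1), assumption+, rule mixture(2), assumption+)
qed

end

section \<open>Coverage of the randomised hull\<close>

theorem theorem3p4:
  fixes M :: "'w measure" and P :: "'x measure"
    and X :: "nat \<Rightarrow> 'w \<Rightarrow> 'x" and V :: "'w \<Rightarrow> real"
    and S :: "nat \<Rightarrow> 'w \<Rightarrow> nat \<Rightarrow> nat set"
    and \<A> :: "'x list \<Rightarrow> real ^ 'd::finite"
    and \<theta>\<^sub>0 :: "real ^ 'd" and \<alpha> \<delta> :: real and n B :: nat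
  defines "B \<equiv> hull_B \<alpha> CARD('d)"
  assumes "prob_space M" and "prob_space P"
    and "0 < \<alpha>" and "\<alpha> < 1" and "n \<ge> B"
    and iid: "prob_space.indep_vars M (\<lambda>_. P) X {1..n}"
      "\<And>i. i \<in> {1..n} \<Longrightarrow> distr M P (X i) = P"
    and "estimation_procedure P \<A>"
    and uniform: "distr M borel V = uniform_measure lborel {0..1}"
    and indep: "indep_rv M
      (\<Pi>\<^sub>M i\<in>{1..n}. P) (\<lambda>\<omega>. \<lambda>i\<in>{1..n}. X i \<omega>)
      (borel \<Otimes>\<^sub>M (count_space (batch_splits n (B - 1)) \<Otimes>\<^sub>M count_space (batch_splits n B)))
      (\<lambda>\<omega>. (V \<omega>, S (B - 1) \<omega>, S B \<omega>))"
    and "\<delta> \<ge> 0"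
    and mch: "\<And>b k. b \<in> {B - 1, B} \<Longrightarrow> k \<in> {1..b} \<Longrightarrow>
      MCH M (\<lambda>\<omega>. batch_estimator \<A> X (S b) k \<omega> - \<theta>\<^sub>0)"
    and bias: "\<And>b k. b \<in> {B - 1, B} \<Longrightarrow> k \<in> {1..b} \<Longrightarrow>
      O_Med_bias M (batch_estimator \<A> X (S b) k) \<theta>\<^sub>0 \<le> \<delta>"
  shows "\<alpha> - 2 ^ (CARD('d) - 1) * real B * (real B - 1) * \<delta>\<^sup>2
           \<le> measure M {\<omega> \<in> space M. \<theta>\<^sub>0 \<notin> hull_CI \<A> X V S \<alpha> \<omega>}
       \<and> measure M {\<omega> \<in> space M. \<theta>\<^sub>0 \<notin> hull_CI \<A> X V S \<alpha> \<omega>}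
           \<le> \<alpha> + 2 ^ (CARD('d) - 1) * real B * (real B - 1) * \<delta>\<^sup>2"
proof -
  interpret prob_space M by (rule assms(2))
  interpret iid_estimation M P X n \<A>
    by (intro iid_estimation.intro iid_estimation_axioms.intro prob_space_axioms iid
        \<open>estimation_procedure P \<A>\<close> \<open>prob_space P\<close>)
  define \<tau> where "\<tau> = hull_tau \<alpha> CARD('d)"
  have d: "CARD('d) \<ge> 1" using finite_UNIV_card_ge_0[where 'a = 'd] by simp
  have B2: "B \<ge> 2" using hull_B_bounds(1)[OF \<open>0 < \<alpha>\<close> \<open>\<alpha> < 1\<close> d] by (simp add: B_def)
  have \<tau>: "0 \<le> \<tau>" "\<tau> \<le> 1" "\<tau> * hull_U (B - 1) CARD('d) + (1 - \<tau>) * hull_U B CARD('d) = \<alpha>"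
    using hull_tau_bounds[OF \<open>0 < \<alpha>\<close> \<open>\<alpha> < 1\<close> d] by (simp_all add: \<tau>_def B_def)
  have V: "V \<in> borel_measurable M"
  proof -
    have "(\<lambda>\<omega>. (V \<omega>, S (B - 1) \<omega>, S B \<omega>)) \<in> measurable M
        (borel \<Otimes>\<^sub>M (count_space (batch_splits n (B - 1)) \<Otimes>\<^sub>M count_space (batch_splits n B)))"
      using indep by (simp only: indep_rv_def)
    from measurable_compose[OF this measurable_fst] show ?thesis by simp
  qed
  have ind1: "indep_rv M (\<Pi>\<^sub>M i\<in>{1..n}. P) (\<lambda>\<omega>. \<lambda>i\<in>{1..n}. X i \<omega>)
      (borel \<Otimes>\<^sub>M count_space (batch_splits n (B - 1))) (\<lambda>\<omega>. (V \<omega>, S (B - 1) \<omega>))"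
    using indep_rv_compose[OF prob_space_axioms indep, of "\<lambda>t. (fst t, fst (snd t))"] by simp
  have ind2: "indep_rv M (\<Pi>\<^sub>M i\<in>{1..n}. P) (\<lambda>\<omega>. \<lambda>i\<in>{1..n}. X i \<omega>)
      (borel \<Otimes>\<^sub>M count_space (batch_splits n B)) (\<lambda>\<omega>. (V \<omega>, S B \<omega>))"
    using indep_rv_compose[OF prob_space_axioms indep, of "\<lambda>t. (fst t, snd (snd t))"] by simp
  \<comment> \<open>The miss with \<open>b\<close> batches, irrespective of whether V selects
    \<open>b\<close>. The miss event is cut at V = \<tau> into two such events, each involving a
    single split.\<close>
  define E where "E b D = {\<omega> \<in> space M. V \<omega> \<in> D \<and>
      \<theta>\<^sub>0 \<notin> rectangular_hull b (\<lambda>k. batch_estimator \<A> X (S b) k \<omega>)}" for b D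
  have rng: "1 \<le> B - 1" "B - 1 \<le> n" "1 \<le> B" using B2 \<open>n \<ge> B\<close> by auto
  have k1: "1 \<in> {1..B - 1}" "1 \<in> {1..B}" using rng by auto
  obtain c1 where c1: "\<bar>c1 - hull_U (B - 1) CARD('d)\<bar>
      \<le> 2 ^ (CARD('d) - 1) * (real (B - 1) * (real (B - 1) - 1)) * \<delta>\<^sup>2"
    and E1: "\<forall>D\<in>sets borel. E (B - 1) D \<in> events \<and> prob (E (B - 1) D) = c1 * prob {\<omega> \<in> space M. V \<omega> \<in> D}"
    using hull_miss_approx[OF ind1 rng(1,2) \<open>\<delta> \<ge> 0\<close> mch[OF insertI1 k1(1)] bias[OF insertI1 k1(1)]]
    unfolding E_def by blast
  have "B \<in> {B - 1, B}" by simp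
  obtain c2 where c2: "\<bar>c2 - hull_U B CARD('d)\<bar>
      \<le> 2 ^ (CARD('d) - 1) * (real B * (real B - 1)) * \<delta>\<^sup>2"
    and E2: "\<forall>D\<in>sets borel. E B D \<in> events \<and> prob (E B D) = c2 * prob {\<omega> \<in> space M. V \<omega> \<in> D}"
    using hull_miss_approx[OF ind2 rng(3) \<open>n \<ge> B\<close> \<open>\<delta> \<ge> 0\<close>
        mch[OF \<open>B \<in> {B - 1, B}\<close> k1(2)] bias[OF \<open>B \<in> {B - 1, B}\<close> k1(2)]]
    unfolding E_def by blast
  have VD: "prob {\<omega> \<in> space M. V \<omega> \<in> D} = measure lborel ({0..1} \<inter> D)" if "D \<in> sets borel" for D
  proof -
    have "prob {\<omega> \<in> space M. V \<omega> \<in> D} = measure (distr M borel V) D"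
      by (subst measure_distr[OF V that]) (simp add: vimage_def Int_def conj_commute)
    also have "\<dots> = measure lborel ({0..1} \<inter> D)"
      unfolding uniform using that by (subst measure_uniform_measure) auto
    finally show ?thesis .
  qed
  have "{0..1} \<inter> {..\<tau>} = {0..\<tau>}" "{0..1} \<inter> {\<tau><..} = {\<tau><..1}" using \<tau> by auto
  then have pV: "prob {\<omega> \<in> space M. V \<omega> \<in> {..\<tau>}} = \<tau>" "prob {\<omega> \<in> space M. V \<omega> \<in> {\<tau><..}} = 1 - \<tau>"
    using VD[of "{..\<tau>}"] VD[of "{\<tau><..}"] \<tau> by simp_all
  define K where "K = 2 ^ (CARD('d) - 1) * (real B * (real B - 1)) * \<delta>\<^sup>2"
  let ?miss = "{\<omega> \<in> space M. \<theta>\<^sub>0 \<notin> hull_CI \<A> X V S \<alpha> \<omega>}"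
  have miss: "prob ?miss = c1 * \<tau> + c2 * (1 - \<tau>)"
  proof -
    have "?miss = E (B - 1) {..\<tau>} \<union> E B {\<tau><..}"
    proof (intro set_eqI)
      fix \<omega>
      show "\<omega> \<in> ?miss \<longleftrightarrow> \<omega> \<in> E (B - 1) {..\<tau>} \<union> E B {\<tau><..}"
        by (cases "V \<omega> \<le> \<tau>")
          (simp_all add: E_def hull_CI_def Let_def hull_B_star_def \<tau>_def B_def)
    qed
    moreover have "E (B - 1) {..\<tau>} \<inter> E B {\<tau><..} = {}" by (auto simp: E_def)
    ultimately have "prob ?miss = prob (E (B - 1) {..\<tau>}) + prob (E B {\<tau><..})"
      using E1 E2 by (simp add: finite_measure_Union)
    then show ?thesis using E1 E2 pV by simp
  qed
  \<comment> \<open>The error bound increases with the number of batches, so the one for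
    \<open>B\<close> covers both cases.\<close>
  have c1': "\<bar>c1 - hull_U (B - 1) CARD('d)\<bar> \<le> K"
  proof -
    have "real (B - 1) * (real (B - 1) - 1) \<le> real B * (real B - 1)"
      using B2 by (intro mult_mono) (auto simp: of_nat_diff)
    then have "2 ^ (CARD('d) - 1) * (real (B - 1) * (real (B - 1) - 1)) * \<delta>\<^sup>2 \<le> K"
      unfolding K_def by (intro mult_right_mono mult_left_mono) auto
    then show ?thesis using c1 by linarith
  qed
  \<comment> \<open>\<alpha> is the same convex combination of the two values of
    \<open>hull_U\<close>, so the errors are averaged with weights \<tau> and 1 - \<tau>.\<close>
  have "prob ?miss - \<alpha> = \<tau> * (c1 - hull_U (B - 1) CARD('d)) + (1 - \<tau>) * (c2 - hull_U B CARD('d))"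
    unfolding miss using \<tau>(3) by (simp add: algebra_simps)
  also have "\<bar>\<dots>\<bar> \<le> \<tau> * K + (1 - \<tau>) * K"
    using \<tau> c1' c2
    by (intro order.trans[OF abs_triangle_ineq] add_mono) (auto simp: abs_mult K_def intro!: mult_left_mono)
  also have "\<dots> = K" by (simp add: algebra_simps)
  finally have "\<bar>prob ?miss - \<alpha>\<bar> \<le> K" .
  then show ?thesis unfolding K_def by (simp only: mult.assoc abs_le_iff) linarith
qed

end
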